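(* Let $(M^{2n+1},\phi,\xi,\eta,g)$ be an almost $\alpha$-paracosymplectic manifold with fundamental 2-form $\Phi$, and let $\mathcal{A}X=-\nabla_X\xi$. Then for all vector fields $X,Y$ on $M$: (i) $\mathcal{L}_\xi\eta=0$; (ii) $g(\mathcal{A}X,Y)=g(X,\mathcal{A}Y)$; (iii) $\mathcal{A}\xi=0$; (iv) $\mathcal{L}_\xi\Phi=2\alpha\Phi$; (v) $(\mathcal{L}_\xi g)(X,Y)=-2g(\mathcal{A}X,Y)$; (vi) $\eta(\mathcal{A}X)=0$; (vii) if $n\geq 2$, then $d\alpha=f\eta$ for some smooth function $f$ on $M$. Here $\mathcal{L}$ denotes the Lie derivative.
   Context: An almost paracontact metric manifold is a smooth manifold $M$ of dimension $2n+1$ with a $(1,1)$-tensor field $\phi$, a vector field $\xi$, a 1-form $\eta$ and a pseudo-Riemannian metric $g$ of signature $(n+1,n)$ such that $\eta(\xi)=1$, $\phi^2=\mathrm{Id}-\eta\otimes\xi$, the eigendistributions of $\phi|_{\ker\eta}$ for the eigenvalues $+1$ and $-1$ both have rank $n$, and $g(\phi X,\phi Y)=-g(X,Y)+\eta(X)\eta(Y)$ (hence $\eta(X)=g(X,\xi)$, $\phi\xi=0$, $\eta\circ\phi=0$). Its fundamental 2-form is $\Phi(X,Y)=g(\phi X,Y)$. It is almost $\alpha$-paracosymplectic, where $\alpha$ is a smooth real function on $M$ (possibly constant), if $d\eta=0$ and $d\Phi=2\alpha\,\eta\wedge\Phi$ (with $d$ and $\wedge$ normalized compatibly, so that the cyclic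 sum of $(\nabla_X\Phi)(Y,Z)$ equals $2\alpha$ times the cyclic sum of $\eta(X)\Phi(Y,Z)$). $\nabla$ is the Levi-Civita connection of $g$. *)

theory Defs
  imports "HOL-Analysis.Analysis" "HOL-Library.Function_Algebras"
begin

instantiation "fun" :: (type, scaleR) scaleR
begin

definition "scaleR_fun c f = (\<lambda>x. c *\<^sub>R f x)"

instance ..

end

instance "fun" :: (type, real_vector) real_vector
  by standard (simp_all add: scaleR_fun_def plus_fun_def fun_eq_iff scaleR_add_right scaleR_add_left)


section \<open>Smooth manifolds\<close>

text \<open>Only meant for open \<open>S\<close>: there, the value of the Frechet derivative on \<open>S\<close> does not
  depend on \<open>f\<close> outside \<open>S\<close>.\<close>

fun C_k_on :: "nat \<Rightarrow> 'a::real_normed_vector set \<Rightarrow> ('a \<Rightarrow> 'b::real_normed_vector) \<Rightarrow> bool" where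
  "C_k_on 0 S f \<longleftrightarrow> continuous_on S f"
| "C_k_on (Suc k) S f \<longleftrightarrow>
     (\<forall>x\<in>S. f differentiable (at x)) \<and> (\<forall>v. C_k_on k S (\<lambda>x. frechet_derivative f (at x) v))"

definition smooth_on :: "'a::real_normed_vector set \<Rightarrow> ('a \<Rightarrow> 'b::real_normed_vector) \<Rightarrow> bool" where
  "smooth_on S f \<longleftrightarrow> (\<forall>k. C_k_on k S f)"

text \<open>A chart is a domain together with a coordinate map. The manifold is the whole type \<open>'m\<close>, and
  the smooth structure is given by an atlas, which is not required to be maximal.\<close>

type_synonym ('m, 'e) chart = "'m set \<times> ('m \<Rightarrow> 'e)"

locale smooth_manifold =
  fixes A :: "('m::{t2_space, second_countable_topology}, 'e::euclidean_space) chart set"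
  assumes chart_open: "(U, x) \<in> A \<Longrightarrow> open U \<and> open (x ` U)"
    and chart_inj: "(U, x) \<in> A \<Longrightarrow> inj_on x U"
    and chart_homeo: "(U, x) \<in> A \<Longrightarrow> homeomorphism U (x ` U) x (inv_into U x)"
    and charts_cover: "(\<Union>(U, x)\<in>A. U) = UNIV"
    and charts_compatible:
      "(U, x) \<in> A \<Longrightarrow> (V, y) \<in> A \<Longrightarrow> smooth_on (x ` (U \<inter> V)) (y \<circ> inv_into U x)"

definition smooth_funs ::
  "('m::{t2_space, second_countable_topology}, 'e::euclidean_space) chart set \<Rightarrow> ('m \<Rightarrow> real) set" where
  "smooth_funs A = {f. \<forall>(U, x)\<in>A. smooth_on (x ` U) (f \<circ> inv_into U x)}"

text \<open>Tangent vectors at \<open>p\<close> are the derivations at \<open>p\<close> of the algebra of smooth functions. Fixing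
  the value \<open>0\<close> on non-smooth functions makes a derivation a unique element of the function type.\<close>

type_synonym 'm tvec = "('m \<Rightarrow> real) \<Rightarrow> real"

definition tangent_space ::
  "('m::{t2_space, second_countable_topology}, 'e::euclidean_space) chart set \<Rightarrow> 'm \<Rightarrow> 'm tvec set" where
  "tangent_space A p = {v.
     (\<forall>f. f \<notin> smooth_funs A \<longrightarrow> v f = 0) \<and>
     (\<forall>f\<in>smooth_funs A. \<forall>h\<in>smooth_funs A. v (f + h) = v f + v h) \<and>
     (\<forall>c. \<forall>f\<in>smooth_funs A. v (c *\<^sub>R f) = c * v f) \<and>
     (\<forall>f\<in>smooth_funs A. \<forall>h\<in>smooth_funs A. v (f * h) = f p * v h + h p * v f)}"

type_synonym 'm vfield = "'m \<Rightarrow> 'm tvec"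

definition vf_app :: "'m vfield \<Rightarrow> ('m \<Rightarrow> real) \<Rightarrow> 'm \<Rightarrow> real" where
  "vf_app X f = (\<lambda>p. X p f)"

definition vfields ::
  "('m::{t2_space, second_countable_topology}, 'e::euclidean_space) chart set \<Rightarrow> 'm vfield set" where
  "vfields A = {X. (\<forall>p. X p \<in> tangent_space A p) \<and>
                   (\<forall>f\<in>smooth_funs A. vf_app X f \<in> smooth_funs A)}"

definition fun_mult :: "('m \<Rightarrow> real) \<Rightarrow> 'm vfield \<Rightarrow> 'm vfield" where
  "fun_mult f X = (\<lambda>p. f p *\<^sub>R X p)"

text \<open>No case distinction is needed to obtain \<open>0\<close> on non-smooth \<open>f\<close>: there \<open>vf_app X f\<close> and
  \<open>vf_app Y f\<close> vanish identically.\<close>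

definition lie_bracket :: "'m vfield \<Rightarrow> 'm vfield \<Rightarrow> 'm vfield" where
  "lie_bracket X Y = (\<lambda>p f. X p (vf_app Y f) - Y p (vf_app X f))"

definition differential :: "('m \<Rightarrow> real) \<Rightarrow> 'm \<Rightarrow> 'm tvec \<Rightarrow> real" where
  "differential f p v = v f"


section \<open>Tensor fields\<close>

text \<open>A tensor field is pointwise a (multi)linear map on tangent spaces, unconstrained off the
  tangent spaces, and is smooth if it sends smooth vector fields to smooth objects.\<close>

definition linear_on_space :: "'a::real_vector set \<Rightarrow> ('a \<Rightarrow> 'b::real_vector) \<Rightarrow> bool" where
  "linear_on_space V L \<longleftrightarrow>
     (\<forall>u\<in>V. \<forall>v\<in>V. L (u + v) = L u + L v) \<and> (\<forall>c. \<forall>v\<in>V. L (c *\<^sub>R v) = c *\<^sub>R L v)"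

definition eval1 :: "('m \<Rightarrow> 'm tvec \<Rightarrow> 'b) \<Rightarrow> 'm vfield \<Rightarrow> 'm \<Rightarrow> 'b" where
  "eval1 T X = (\<lambda>p. T p (X p))"

definition eval2 :: "('m \<Rightarrow> 'm tvec \<Rightarrow> 'm tvec \<Rightarrow> real) \<Rightarrow> 'm vfield \<Rightarrow> 'm vfield \<Rightarrow> 'm \<Rightarrow> real" where
  "eval2 T X Y = (\<lambda>p. T p (X p) (Y p))"

definition one_form ::
  "('m::{t2_space, second_countable_topology}, 'e::euclidean_space) chart set
   \<Rightarrow> ('m \<Rightarrow> 'm tvec \<Rightarrow> real) \<Rightarrow> bool" where
  "one_form A \<eta> \<longleftrightarrow>
     (\<forall>p. linear_on_space (tangent_space A p) (\<eta> p)) \<and>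
     (\<forall>X\<in>vfields A. eval1 \<eta> X \<in> smooth_funs A)"

definition tensor_1_1 ::
  "('m::{t2_space, second_countable_topology}, 'e::euclidean_space) chart set
   \<Rightarrow> ('m \<Rightarrow> 'm tvec \<Rightarrow> 'm tvec) \<Rightarrow> bool" where
  "tensor_1_1 A \<phi> \<longleftrightarrow>
     (\<forall>p. \<forall>v\<in>tangent_space A p. \<phi> p v \<in> tangent_space A p) \<and>
     (\<forall>p. linear_on_space (tangent_space A p) (\<phi> p)) \<and>
     (\<forall>X\<in>vfields A. eval1 \<phi> X \<in> vfields A)"

definition tensor_0_2 ::
  "('m::{t2_space, second_countable_topology}, 'e::euclidean_space) chart set
   \<Rightarrow> ('m \<Rightarrow> 'm tvec \<Rightarrow> 'm tvec \<Rightarrow> real) \<Rightarrow> bool" where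
  "tensor_0_2 A T \<longleftrightarrow>
     (\<forall>p. \<forall>u\<in>tangent_space A p. linear_on_space (tangent_space A p) (T p u)) \<and>
     (\<forall>p. \<forall>v\<in>tangent_space A p. linear_on_space (tangent_space A p) (\<lambda>u. T p u v)) \<and>
     (\<forall>X\<in>vfields A. \<forall>Y\<in>vfields A. eval2 T X Y \<in> smooth_funs A)"

text \<open>The exterior derivative and the wedge product carry no factors \<open>1/(k+1)\<close>: the wedge is the
  sum over shuffles, \<open>d\<close> is the matching invariant formula.\<close>

definition ext_d1 :: "('m \<Rightarrow> 'm tvec \<Rightarrow> real) \<Rightarrow> 'm vfield \<Rightarrow> 'm vfield \<Rightarrow> 'm \<Rightarrow> real" where
  "ext_d1 \<eta> X Y =
     vf_app X (eval1 \<eta> Y) - vf_app Y (eval1 \<eta> X) - eval1 \<eta> (lie_bracket X Y)"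

definition ext_d2 :: "('m \<Rightarrow> 'm tvec \<Rightarrow> 'm tvec \<Rightarrow> real)
   \<Rightarrow> 'm vfield \<Rightarrow> 'm vfield \<Rightarrow> 'm vfield \<Rightarrow> 'm \<Rightarrow> real" where
  "ext_d2 \<omega> X Y Z =
     vf_app X (eval2 \<omega> Y Z) - vf_app Y (eval2 \<omega> X Z) + vf_app Z (eval2 \<omega> X Y)
     - eval2 \<omega> (lie_bracket X Y) Z + eval2 \<omega> (lie_bracket X Z) Y - eval2 \<omega> (lie_bracket Y Z) X"

definition wedge_1_2 :: "('m \<Rightarrow> 'm tvec \<Rightarrow> real) \<Rightarrow> ('m \<Rightarrow> 'm tvec \<Rightarrow> 'm tvec \<Rightarrow> real)
   \<Rightarrow> 'm vfield \<Rightarrow> 'm vfield \<Rightarrow> 'm vfield \<Rightarrow> 'm \<Rightarrow> real" where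
  "wedge_1_2 \<eta> \<omega> X Y Z =
     eval1 \<eta> X * eval2 \<omega> Y Z - eval1 \<eta> Y * eval2 \<omega> X Z + eval1 \<eta> Z * eval2 \<omega> X Y"

definition lie_deriv1 :: "'m vfield \<Rightarrow> ('m \<Rightarrow> 'm tvec \<Rightarrow> real) \<Rightarrow> 'm vfield \<Rightarrow> 'm \<Rightarrow> real" where
  "lie_deriv1 Z \<eta> X = vf_app Z (eval1 \<eta> X) - eval1 \<eta> (lie_bracket Z X)"

definition lie_deriv2 :: "'m vfield \<Rightarrow> ('m \<Rightarrow> 'm tvec \<Rightarrow> 'm tvec \<Rightarrow> real)
   \<Rightarrow> 'm vfield \<Rightarrow> 'm vfield \<Rightarrow> 'm \<Rightarrow> real" where
  "lie_deriv2 Z T X Y =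
     vf_app Z (eval2 T X Y) - eval2 T (lie_bracket Z X) Y - eval2 T X (lie_bracket Z Y)"


section \<open>Pseudo-Riemannian metrics and the Levi-Civita connection\<close>

definition has_signature :: "'a::real_vector set \<Rightarrow> ('a \<Rightarrow> 'a \<Rightarrow> real) \<Rightarrow> nat \<Rightarrow> nat \<Rightarrow> bool" where
  "has_signature V b r s \<longleftrightarrow>
     (\<exists>e::nat \<Rightarrow> 'a. inj_on e {..<r + s} \<and> independent (e ` {..<r + s}) \<and> span (e ` {..<r + s}) = V \<and>
        (\<forall>i<r + s. \<forall>j<r + s. b (e i) (e j) = (if i \<noteq> j then 0 else if i < r then 1 else - 1)))"

definition pseudo_riemannian_metric ::
  "('m::{t2_space, second_countable_topology}, 'e::euclidean_space) chart set
   \<Rightarrow> ('m \<Rightarrow> 'm tvec \<Rightarrow> 'm tvec \<Rightarrow> real) \<Rightarrow> nat \<Rightarrow> nat \<Rightarrow> bool" where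
  "pseudo_riemannian_metric A g r s \<longleftrightarrow>
     tensor_0_2 A g \<and>
     (\<forall>p. \<forall>u\<in>tangent_space A p. \<forall>v\<in>tangent_space A p. g p u v = g p v u) \<and>
     (\<forall>p. has_signature (tangent_space A p) (g p) r s)"

definition affine_connection ::
  "('m::{t2_space, second_countable_topology}, 'e::euclidean_space) chart set
   \<Rightarrow> ('m vfield \<Rightarrow> 'm vfield \<Rightarrow> 'm vfield) \<Rightarrow> bool" where
  "affine_connection A D \<longleftrightarrow>
     (\<forall>X\<in>vfields A. \<forall>Y\<in>vfields A. D X Y \<in> vfields A) \<and>
     (\<forall>X\<in>vfields A. \<forall>Y\<in>vfields A. \<forall>Z\<in>vfields A. D (X + Y) Z = D X Z + D Y Z) \<and>
     (\<forall>f\<in>smooth_funs A. \<forall>X\<in>vfields A. \<forall>Y\<in>vfields A. D (fun_mult f X) Y = fun_mult f (D X Y)) \<and>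
     (\<forall>X\<in>vfields A. \<forall>Y\<in>vfields A. \<forall>Z\<in>vfields A. D X (Y + Z) = D X Y + D X Z) \<and>
     (\<forall>f\<in>smooth_funs A. \<forall>X\<in>vfields A. \<forall>Y\<in>vfields A.
        D X (fun_mult f Y) = fun_mult (vf_app X f) Y + fun_mult f (D X Y))"

definition levi_civita ::
  "('m::{t2_space, second_countable_topology}, 'e::euclidean_space) chart set
   \<Rightarrow> ('m \<Rightarrow> 'm tvec \<Rightarrow> 'm tvec \<Rightarrow> real) \<Rightarrow> ('m vfield \<Rightarrow> 'm vfield \<Rightarrow> 'm vfield) \<Rightarrow> bool" where
  "levi_civita A g D \<longleftrightarrow>
     affine_connection A D \<and>
     (\<forall>X\<in>vfields A. \<forall>Y\<in>vfields A. D X Y - D Y X = lie_bracket X Y) \<and>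
     (\<forall>X\<in>vfields A. \<forall>Y\<in>vfields A. \<forall>Z\<in>vfields A.
        vf_app X (eval2 g Y Z) = eval2 g (D X Y) Z + eval2 g Y (D X Z))"


section \<open>Almost paracontact metric and almost paracosymplectic manifolds\<close>

locale almost_paracontact_metric = smooth_manifold A
  for A :: "('m::{t2_space, second_countable_topology}, 'e::euclidean_space) chart set" +
  fixes n :: nat
    and \<phi> :: "'m \<Rightarrow> 'm tvec \<Rightarrow> 'm tvec"
    and \<xi> :: "'m vfield"
    and \<eta> :: "'m \<Rightarrow> 'm tvec \<Rightarrow> real"
    and g :: "'m \<Rightarrow> 'm tvec \<Rightarrow> 'm tvec \<Rightarrow> real"
  assumes dimension: "DIM('e) = 2 * n + 1"
    and phi_tensor: "tensor_1_1 A \<phi>"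
    and xi_field: "\<xi> \<in> vfields A"
    and eta_form: "one_form A \<eta>"
    and metric: "pseudo_riemannian_metric A g (n + 1) n"
    and eta_xi: "\<eta> p (\<xi> p) = 1"
    and phi_sq: "v \<in> tangent_space A p \<Longrightarrow> \<phi> p (\<phi> p v) = v - \<eta> p v *\<^sub>R \<xi> p"
    and rank_plus: "dim {v \<in> tangent_space A p. \<eta> p v = 0 \<and> \<phi> p v = v} = n"
    and rank_minus: "dim {v \<in> tangent_space A p. \<eta> p v = 0 \<and> \<phi> p v = - v} = n"
    and compatible: "u \<in> tangent_space A p \<Longrightarrow> v \<in> tangent_space A p \<Longrightarrow>
      g p (\<phi> p u) (\<phi> p v) = - g p u v + \<eta> p u * \<eta> p v"

definition fundamental_form :: "('m \<Rightarrow> 'm tvec \<Rightarrow> 'm tvec) \<Rightarrow> ('m \<Rightarrow> 'm tvec \<Rightarrow> 'm tvec \<Rightarrow> real)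
   \<Rightarrow> 'm \<Rightarrow> 'm tvec \<Rightarrow> 'm tvec \<Rightarrow> real" where
  "fundamental_form \<phi> g p u v = g p (\<phi> p u) v"

locale almost_alpha_paracosymplectic = almost_paracontact_metric A n \<phi> \<xi> \<eta> g
  for A :: "('m::{t2_space, second_countable_topology}, 'e::euclidean_space) chart set"
    and n \<phi> \<xi> \<eta> g +
  fixes \<alpha> :: "'m \<Rightarrow> real"
  assumes alpha_smooth: "\<alpha> \<in> smooth_funs A"
    and d_eta: "X \<in> vfields A \<Longrightarrow> Y \<in> vfields A \<Longrightarrow> ext_d1 \<eta> X Y = 0"
    and d_Phi: "X \<in> vfields A \<Longrightarrow> Y \<in> vfields A \<Longrightarrow> Z \<in> vfields A \<Longrightarrow>
      ext_d2 (fundamental_form \<phi> g) X Y Z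
        = 2 *\<^sub>R (\<alpha> * wedge_1_2 \<eta> (fundamental_form \<phi> g) X Y Z)"

definition shape_operator ::
  "('m vfield \<Rightarrow> 'm vfield \<Rightarrow> 'm vfield) \<Rightarrow> 'm vfield \<Rightarrow> 'm vfield \<Rightarrow> 'm vfield" where
  "shape_operator D \<xi> X = - D X \<xi>"

end

theory Submission
  imports Defs "HOL-Computational_Algebra.Polynomial"
begin

text \<open>
  Parts (i)--(vi) are formal. Compatibility of \<open>g\<close> and \<open>\<phi>\<close> gives \<open>\<eta> = g(\<cdot>, \<xi>)\<close>, \<open>\<phi> \<xi> = 0\<close>,
  \<open>\<eta> \<circ> \<phi> = 0\<close> and the skewness of \<open>\<Phi>\<close>; as \<open>\<eta>(\<xi>)\<close> is constant and \<open>\<xi>\<close> lies in the kernel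
  of \<open>\<Phi>\<close>, inserting \<open>\<xi>\<close> into \<open>d\<eta>\<close> and \<open>d\<Phi>\<close> yields \<open>L\<^sub>\<xi>\<eta> = 0\<close> and \<open>L\<^sub>\<xi>\<Phi> = 2\<alpha>\<Phi>\<close> (Cartan's
  formula). Closedness of \<open>\<eta> = g(\<cdot>, \<xi>)\<close> is the symmetry of \<open>\<nabla>\<xi>\<close>, and \<open>g(\<xi>, \<xi>) = 1\<close> gives
  \<open>\<eta>(\<nabla>\<^sub>X\<xi>) = 0\<close>. Together, \<open>g(\<nabla>\<^sub>\<xi>\<xi>, Y) = g(\<xi>, \<nabla>\<^sub>Y\<xi>) = 0\<close> for every vector field \<open>Y\<close>, so that
  \<open>\<nabla>\<^sub>\<xi>\<xi> = 0\<close> by nondegeneracy.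

  For (vii), apply \<open>L\<^sub>\<xi> d = d L\<^sub>\<xi>\<close> (\<open>lie_deriv_ext_d2_commute\<close>) to \<open>\<Phi>\<close>. The left side is
  \<open>L\<^sub>\<xi>(2\<alpha> \<eta> \<and> \<Phi>) = 2 \<xi>(\<alpha>) \<eta> \<and> \<Phi> + 4\<alpha>\<^sup>2 \<eta> \<and> \<Phi>\<close>, the right side
  \<open>d(2\<alpha>\<Phi>) = 2 d\<alpha> \<and> \<Phi> + 4\<alpha>\<^sup>2 \<eta> \<and> \<Phi>\<close>; hence \<open>(d\<alpha> - \<xi>(\<alpha>) \<eta>) \<and> \<Phi> = 0\<close>. If \<open>n \<ge> 2\<close>, the wedge
  product with \<open>\<Phi>\<close> is injective on covectors (\<open>wedge_Phi_injective\<close>), and \<open>f = \<xi>(\<alpha>)\<close>.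

  The two passages from vector fields to single tangent vectors (nondegeneracy in (iii),
  injectivity in (vii)) require that each tangent vector is the value of a global vector field
  (\<open>tangent_vector_extends\<close>). With tangent vectors as derivations, one would usually first show
  by Hadamard's lemma that the coordinate derivations span the tangent space. Here this
  is a matter of counting: the signature of \<open>g\<close> exhibits a basis of the tangent space with as many
  elements as the model space has dimensions, and the coordinate derivations, damped by
  a bump function so as to be globally defined, are equally many and independent.
\<close>

section \<open>Calculus of smooth functions\<close>

text \<open>As a rewrite rule this equation would unfold differentiability orders that the proofs keep
  folded as induction hypotheses.\<close>

declare C_k_on.simps(2) [simp del]

lemma C_k_on_frechet_derivative:
  "C_k_on (Suc k) S f \<Longrightarrow> C_k_on k S (\<lambda>x. frechet_derivative f (at x) v)"
  by (simp add: C_k_on.simps(2))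

lemma C_k_on_transfer:
  assumes "open S" "C_k_on k S f" "\<And>x. x \<in> S \<Longrightarrow> f x = g x"
  shows "C_k_on k S g"
  using assms(2,3)
proof (induction k arbitrary: f g)
  case 0
  then show ?case by (simp cong: continuous_on_cong)
next
  case (Suc k)
  have D: "(g has_derivative frechet_derivative f (at x)) (at x)" if "x \<in> S" for x
  proof (rule has_derivative_transform_within_open[OF _ assms(1) that])
    show "(f has_derivative frechet_derivative f (at x)) (at x)"
      using Suc.prems(1) that by (simp add: C_k_on.simps(2) frechet_derivative_works)
  qed (fact Suc.prems(2))
  have "C_k_on k S (\<lambda>x. frechet_derivative g (at x) v)" for v
  proof (rule Suc.IH)
    show "C_k_on k S (\<lambda>x. frechet_derivative f (at x) v)"
      using Suc.prems(1) by (rule C_k_on_frechet_derivative)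
    show "frechet_derivative f (at x) v = frechet_derivative g (at x) v" if "x \<in> S" for x
      using frechet_derivative_at[OF D[OF that]] by simp
  qed
  then show ?case using D by (auto simp: C_k_on.simps(2) differentiable_def)
qed

lemma C_k_on_subset: "C_k_on k T f \<Longrightarrow> S \<subseteq> T \<Longrightarrow> C_k_on k S f"
  by (induction k arbitrary: f) (auto simp: C_k_on.simps(2) intro: continuous_on_subset)

lemma C_k_on_Un:
  "open S \<Longrightarrow> open T \<Longrightarrow> C_k_on k S f \<Longrightarrow> C_k_on k T f \<Longrightarrow> C_k_on k (S \<union> T) f"
  by (induction k arbitrary: f) (auto simp: C_k_on.simps(2) intro: continuous_on_open_Un)

lemma C_k_on_Suc_imp: "C_k_on (Suc k) S f \<Longrightarrow> C_k_on k S f"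
proof (induction k arbitrary: f)
  case 0
  then show ?case
    by (auto simp: C_k_on.simps(2)
        intro!: continuous_at_imp_continuous_on differentiable_imp_continuous_within)
next
  case (Suc k)
  have "C_k_on k S (\<lambda>x. frechet_derivative f (at x) v)" for v
    using Suc.prems by (intro Suc.IH C_k_on_frechet_derivative)
  then show ?case using Suc.prems by (simp add: C_k_on.simps(2)[where f = f])
qed

text \<open>A derivative given by any formula may replace the Frechet derivative operator; the closure
  properties below follow from it by induction on the order.\<close>

lemma C_k_on_SucI:
  assumes "open S" "\<And>x. x \<in> S \<Longrightarrow> (f has_derivative D x) (at x)"
    and "\<And>v. C_k_on k S (\<lambda>x. D x v)"
  shows "C_k_on (Suc k) S f"
proof -
  have "C_k_on k S (\<lambda>x. frechet_derivative f (at x) v)" for v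
    by (rule C_k_on_transfer[OF assms(1,3)]) (simp add: frechet_derivative_at[OF assms(2), symmetric])
  then show ?thesis using assms(2) by (auto simp: C_k_on.simps(2) differentiable_def)
qed

lemma C_k_on_SucD:
  assumes "C_k_on (Suc k) S f" "x \<in> S"
  shows "(f has_derivative frechet_derivative f (at x)) (at x)"
  using assms by (simp add: C_k_on.simps(2) frechet_derivative_works)

lemma C_k_on_const: "open S \<Longrightarrow> C_k_on k S (\<lambda>x. c)"
proof (induction k arbitrary: c)
  case (Suc k)
  then show ?case by (intro C_k_on_SucI[where D = "\<lambda>x v. 0"]) auto
qed simp

lemma C_k_on_bounded_linear_comp:
  assumes "bounded_linear L" "open S"
  shows "C_k_on k S f \<Longrightarrow> C_k_on k S (\<lambda>x. L (f x))"
proof (induction k arbitrary: f)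
  case 0
  then show ?case using assms by (auto intro: bounded_linear.continuous_on)
next
  case (Suc k)
  show ?case
  proof (rule C_k_on_SucI[OF assms(2)])
    show "((\<lambda>x. L (f x)) has_derivative (\<lambda>v. L (frechet_derivative f (at x) v))) (at x)"
      if "x \<in> S" for x
      using bounded_linear.has_derivative[OF assms(1) C_k_on_SucD[OF Suc.prems that]] .
    show "C_k_on k S (\<lambda>x. L (frechet_derivative f (at x) v))" for v
      using Suc.prems by (intro Suc.IH C_k_on_frechet_derivative)
  qed
qed

lemma C_k_on_bounded_linear:
  assumes "bounded_linear L" "open S"
  shows "C_k_on k S L"
proof (cases k)
  case 0
  then show ?thesis using assms by (simp add: linear_continuous_on)
next
  case (Suc j)
  show ?thesis unfolding Suc
    by (rule C_k_on_SucI[where D = "\<lambda>x. L"])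
      (auto simp: assms C_k_on_const bounded_linear_imp_has_derivative)
qed

lemma C_k_on_add:
  assumes "open S"
  shows "C_k_on k S f \<Longrightarrow> C_k_on k S g \<Longrightarrow> C_k_on k S (\<lambda>x. f x + g x)"
proof (induction k arbitrary: f g)
  case 0
  then show ?case by (auto intro: continuous_intros)
next
  case (Suc k)
  show ?case
  proof (rule C_k_on_SucI[OF assms])
    show "((\<lambda>x. f x + g x) has_derivative
        (\<lambda>v. frechet_derivative f (at x) v + frechet_derivative g (at x) v)) (at x)" if "x \<in> S" for x
      using that Suc.prems by (blast intro: has_derivative_add C_k_on_SucD)
  qed (use Suc.prems in \<open>intro Suc.IH C_k_on_frechet_derivative\<close>)
qed

lemma C_k_on_sum:
  assumes "open S" "finite I" "\<And>i. i \<in> I \<Longrightarrow> C_k_on k S (f i)"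
  shows "C_k_on k S (\<lambda>x. \<Sum>i\<in>I. f i x)"
  using assms(2,3) by (induction I) (auto simp: assms(1) C_k_on_const C_k_on_add)

lemma C_k_on_mult:
  fixes f g :: "'a::real_normed_vector \<Rightarrow> real"
  assumes "open S"
  shows "C_k_on k S f \<Longrightarrow> C_k_on k S g \<Longrightarrow> C_k_on k S (\<lambda>x. f x * g x)"
proof (induction k arbitrary: f g)
  case 0
  then show ?case by (auto intro: continuous_intros)
next
  case (Suc k)
  show ?case
  proof (rule C_k_on_SucI[OF assms])
    show "((\<lambda>x. f x * g x) has_derivative
        (\<lambda>v. f x * frechet_derivative g (at x) v + frechet_derivative f (at x) v * g x)) (at x)"
      if "x \<in> S" for x
      using that Suc.prems by (blast intro: has_derivative_mult C_k_on_SucD)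
    have "C_k_on k S f" "C_k_on k S g" using Suc.prems C_k_on_Suc_imp by blast+
    then show "C_k_on k S (\<lambda>x. f x * frechet_derivative g (at x) v + frechet_derivative f (at x) v * g x)" for v
      using Suc.prems by (intro C_k_on_add assms Suc.IH C_k_on_frechet_derivative)
  qed
qed

text \<open>The chain rule turns the derivative of the composite into a finite sum of products of functions
  of one order less; expanding along the basis makes the partial derivatives of \<open>f\<close> at \<open>g x\<close>
  composites of the same kind, to which the induction hypothesis applies.\<close>

lemma C_k_on_compose:
  fixes f :: "'b::euclidean_space \<Rightarrow> real" and g :: "'a::real_normed_vector \<Rightarrow> 'b"
  assumes "open S" "g ` S \<subseteq> T"
  shows "C_k_on k S g \<Longrightarrow> C_k_on k T f \<Longrightarrow> C_k_on k S (f \<circ> g)"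
proof (induction k arbitrary: f)
  case 0
  then have "continuous_on S g" "continuous_on (g ` S) f"
    using continuous_on_subset[OF _ assms(2)] by simp_all
  then show ?case unfolding C_k_on.simps(1) by (rule continuous_on_compose)
next
  case (Suc k)
  let ?D = "\<lambda>x v. \<Sum>b\<in>Basis. (frechet_derivative g (at x) v \<bullet> b) * (frechet_derivative f (at (g x)) b)"
  show ?case
  proof (rule C_k_on_SucI[OF assms(1)])
    show "((f \<circ> g) has_derivative ?D x) (at x)" if "x \<in> S" for x
    proof -
      have f: "(f has_derivative frechet_derivative f (at (g x))) (at (g x))"
        using Suc.prems(2) that assms(2) by (auto intro: C_k_on_SucD)
      interpret f: bounded_linear "frechet_derivative f (at (g x))"
        using f by (rule has_derivative_bounded_linear)
      have "?D x v = frechet_derivative f (at (g x)) (frechet_derivative g (at x) v)" for v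
        by (subst (3) euclidean_representation[symmetric])
           (simp add: f.sum f.scaleR)
      then show ?thesis
        using diff_chain_at[OF C_k_on_SucD[OF Suc.prems(1) that] f] by (simp add: o_def)
    qed
    have "C_k_on k S ((\<lambda>y. frechet_derivative f (at y) b) \<circ> g)" for b
      by (rule Suc.IH[OF C_k_on_Suc_imp[OF Suc.prems(1)] C_k_on_frechet_derivative[OF Suc.prems(2)]])
    moreover have "C_k_on k S (\<lambda>x. frechet_derivative g (at x) v \<bullet> b)" for v b
      using Suc.prems(1) by (intro C_k_on_bounded_linear_comp[OF bounded_linear_inner_left] assms C_k_on_frechet_derivative)
    ultimately show "C_k_on k S (\<lambda>x. ?D x v)" for v
      by (intro C_k_on_sum C_k_on_mult assms) (auto simp: o_def)
  qed
qed

section \<open>Bump functions\<close>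

text \<open>The family \<open>P(1/t) e\<^bsup>-1/t\<^esup>\<close>, extended by zero to \<open>t \<le> 0\<close>, contains the function
  \<open>e\<^bsup>-1/t\<^esup>\<close> and is closed under differentiation, so that smoothness is an induction inside it.\<close>

definition flat_poly :: "real poly \<Rightarrow> real \<Rightarrow> real" where
  "flat_poly P t = (if t > 0 then poly P (1 / t) * exp (- (1 / t)) else 0)"

lemma poly_div_exp_tendsto_0: "((\<lambda>s. poly P s * exp (- s)) \<longlongrightarrow> (0::real)) at_top"
proof -
  have "((\<lambda>s. \<Sum>i\<le>degree P. coeff P i * (s ^ i / exp s)) \<longlongrightarrow> (\<Sum>i\<le>degree P. coeff P i * 0)) at_top"
    by (intro tendsto_intros tendsto_power_div_exp_0)
  moreover have "(\<lambda>s. \<Sum>i\<le>degree P. coeff P i * (s ^ i / exp s)) = (\<lambda>s. poly P s * exp (- s))"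
    by (simp add: poly_altdef exp_minus field_simps sum_distrib_right sum_divide_distrib fun_eq_iff)
  ultimately show ?thesis by simp
qed

lemma flat_poly_tendsto_0: "((\<lambda>t. flat_poly P t) \<longlongrightarrow> 0) (at 0)"
proof -
  have "((\<lambda>t. poly P (1 / t) * exp (- (1 / t))) \<longlongrightarrow> (0::real)) (at_right 0)"
    using filterlim_compose[OF poly_div_exp_tendsto_0 filterlim_inverse_at_top_right]
    by (simp add: inverse_eq_divide)
  then have "(flat_poly P \<longlongrightarrow> 0) (at_right 0)"
    by (rule Lim_transform_eventually) (auto simp: eventually_at_filter flat_poly_def)
  moreover have "(flat_poly P \<longlongrightarrow> 0) (at_left 0)"
    by (rule tendsto_eventually) (auto simp: eventually_at_filter flat_poly_def)
  ultimately show ?thesis by (simp add: filterlim_split_at)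
qed

text \<open>For \<open>t > 0\<close> the derivative of \<open>P(s) e\<^bsup>-s\<^esup>\<close> at \<open>s = 1/t\<close> is \<open>s\<^sup>2 (P(s) - P'(s)) e\<^bsup>-s\<^esup>\<close>. At \<open>0\<close> the
  difference quotient is again a member of the family, for the polynomial \<open>X P\<close>, and tends to \<open>0\<close>.\<close>

lemma flat_poly_has_derivative:
  "(flat_poly P has_field_derivative flat_poly ([:0, 0, 1:] * (P - pderiv P)) t) (at t)"
proof -
  consider "t > 0" | "t < 0" | "t = 0" by linarith
  then show ?thesis
  proof cases
    case 1
    have "((\<lambda>t. poly P (1 / t) * exp (- (1 / t))) has_field_derivative
        flat_poly ([:0, 0, 1:] * (P - pderiv P)) t) (at t)"
      using 1 by (auto intro!: derivative_eq_intros simp: flat_poly_def field_simps power2_eq_square)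
    then show ?thesis
      by (rule has_field_derivative_transform_within_open[where S = "{0<..}"])
         (use 1 in \<open>auto simp: flat_poly_def\<close>)
  next
    case 2
    have "((\<lambda>t. 0) has_field_derivative flat_poly ([:0, 0, 1:] * (P - pderiv P)) t) (at t)"
      using 2 by (simp add: flat_poly_def)
    then show ?thesis
      by (rule has_field_derivative_transform_within_open[where S = "{..<0}"])
         (use 2 in \<open>auto simp: flat_poly_def\<close>)
  next
    case 3
    have "(\<lambda>h. (flat_poly P (0 + h) - flat_poly P 0) / h) = flat_poly ([:0, 1:] * P)"
      by (auto simp: flat_poly_def fun_eq_iff)
    then have "(flat_poly P has_field_derivative 0) (at 0)"
      using flat_poly_tendsto_0[of "[:0, 1:] * P"] by (simp add: DERIV_def)
    then show ?thesis using 3 by (simp add: flat_poly_def)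
  qed
qed

lemma C_k_on_flat_poly: "C_k_on k UNIV (flat_poly P)"
proof (induction k arbitrary: P)
  case 0
  then show ?case
    by (auto intro!: continuous_at_imp_continuous_on DERIV_isCont flat_poly_has_derivative)
next
  case (Suc k)
  show ?case
    by (rule C_k_on_SucI[OF _ flat_poly_has_derivative[unfolded has_field_derivative_def]])
       (auto intro!: C_k_on_mult C_k_on_const Suc)
qed

text \<open>A rescaled \<open>e\<^bsup>-1/t\<^esup>\<close> at \<open>t = r\<^sup>2 - |y - a|\<^sup>2\<close>, which is not positive outside the ball.\<close>

lemma smooth_bump_exists:
  fixes a :: "'a::euclidean_space"
  assumes "r > 0"
  obtains B :: "'a \<Rightarrow> real" where "smooth_on UNIV B" "B a = 1" "\<And>y. y \<notin> cball a r \<Longrightarrow> B y = 0"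
proof -
  let ?q = "\<lambda>y. r\<^sup>2 + (-1) * ((y - a) \<bullet> (y - a))"
  define B where "B = (\<lambda>y. (1 / exp (- (1 / r\<^sup>2))) * (flat_poly 1 \<circ> ?q) y)"
  have aff: "C_k_on k UNIV (\<lambda>y::'a. (y - a) \<bullet> v)" for k v
  proof -
    have "C_k_on k UNIV (\<lambda>y. y \<bullet> v + - (a \<bullet> v))"
      by (intro C_k_on_add C_k_on_const C_k_on_bounded_linear bounded_linear_inner_left) auto
    then show ?thesis by (simp add: inner_diff_left)
  qed
  have sq: "C_k_on k UNIV (\<lambda>y::'a. (y - a) \<bullet> (y - a))" for k
  proof (cases k)
    case 0
    then show ?thesis by (auto intro!: continuous_intros)
  next
    case (Suc j)
    show ?thesis unfolding Suc
    proof (rule C_k_on_SucI)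
      show "((\<lambda>y. (y - a) \<bullet> (y - a)) has_derivative (\<lambda>v. (y - a) \<bullet> v + v \<bullet> (y - a))) (at y)" for y
      proof -
        have "((\<lambda>y. y - a) has_derivative (\<lambda>v. v)) (at y)"
          by (auto intro!: derivative_eq_intros)
        from has_derivative_inner[OF this this] show ?thesis .
      qed
      have "C_k_on j UNIV (\<lambda>y. v \<bullet> (y - a))" for v using aff[of j v] by (subst inner_commute)
      then show "C_k_on j UNIV (\<lambda>y. (y - a) \<bullet> v + v \<bullet> (y - a))" for v
        by (intro C_k_on_add aff) auto
    qed auto
  qed
  have "smooth_on UNIV B"
    unfolding smooth_on_def B_def
    by (intro allI C_k_on_mult C_k_on_const C_k_on_compose[where T = UNIV] C_k_on_add sq C_k_on_flat_poly) auto
  moreover have "B a = 1" using assms by (simp add: B_def flat_poly_def)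
  moreover have "B y = 0" if "y \<notin> cball a r" for y
  proof -
    have "r < norm (y - a)" using that by (simp add: dist_norm norm_minus_commute)
    then have "r\<^sup>2 \<le> (norm (y - a))\<^sup>2" using assms by (intro power_mono) auto
    then show ?thesis by (simp add: B_def flat_poly_def dot_square_norm)
  qed
  ultimately show ?thesis using that by blast
qed

section \<open>Smooth functions and vector fields on a manifold\<close>

lemma scaleR_fun_apply [simp]: "(c *\<^sub>R f) x = c *\<^sub>R f x"
  by (simp add: scaleR_fun_def)

context smooth_manifold
begin

lemma smooth_funs_iff:
  "f \<in> smooth_funs A \<longleftrightarrow> (\<forall>U x k. (U, x) \<in> A \<longrightarrow> C_k_on k (x ` U) (f \<circ> inv_into U x))"
  by (auto simp: smooth_funs_def smooth_on_def)

lemma smooth_funs_const: "(\<lambda>_. c) \<in> smooth_funs A"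
  by (auto simp: smooth_funs_iff o_def chart_open C_k_on_const)

lemma smooth_funs_0 [simp]: "0 \<in> smooth_funs A"
  using smooth_funs_const[of 0] by (simp add: zero_fun_def)

lemma smooth_funs_1 [simp]: "1 \<in> smooth_funs A"
  using smooth_funs_const[of 1] by (simp add: one_fun_def)

lemma smooth_funs_add [simp]: "f \<in> smooth_funs A \<Longrightarrow> h \<in> smooth_funs A \<Longrightarrow> f + h \<in> smooth_funs A"
  by (auto simp: smooth_funs_iff plus_fun_def o_def chart_open C_k_on_add)

lemma smooth_funs_mult [simp]: "f \<in> smooth_funs A \<Longrightarrow> h \<in> smooth_funs A \<Longrightarrow> f * h \<in> smooth_funs A"
  by (auto simp: smooth_funs_iff times_fun_def o_def chart_open C_k_on_mult)

lemma smooth_funs_scaleR [simp]: "f \<in> smooth_funs A \<Longrightarrow> c *\<^sub>R f \<in> smooth_funs A"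
  by (auto simp: smooth_funs_iff scaleR_fun_def o_def chart_open C_k_on_mult C_k_on_const)

lemma smooth_funs_uminus [simp]: "f \<in> smooth_funs A \<Longrightarrow> - f \<in> smooth_funs A"
  using smooth_funs_scaleR[of f "-1"] by simp

lemma smooth_funs_diff [simp]: "f \<in> smooth_funs A \<Longrightarrow> h \<in> smooth_funs A \<Longrightarrow> f - h \<in> smooth_funs A"
  using smooth_funs_add[of f "- h"] by simp

lemma inv_chart [simp]: "(U, x) \<in> A \<Longrightarrow> q \<in> U \<Longrightarrow> inv_into U x (x q) = q"
  using chart_inj by (simp add: inv_into_f_f)

lemma open_chart_image:
  assumes "(V, y) \<in> A" "open W"
  shows "open (y ` (V \<inter> W))"
proof -
  have "openin (top_of_set (y ` V)) (y ` (V \<inter> W))"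
    using homeomorphism_imp_open_map[OF chart_homeo[OF assms(1)]] assms(2) by (simp add: openin_open_Int)
  then show ?thesis using chart_open[OF assms(1)] openin_open_trans by blast
qed

text \<open>The Hausdorff property enters here: the image of \<open>K\<close> is compact, hence closed, in the manifold, so that
  every chart domain is covered by two open sets, one inside \<open>U\<close> where the function is the composite
  of \<open>F\<close> with a change of charts, and one off the image of \<open>K\<close> where it vanishes.\<close>

lemma zero_extension_smooth:
  assumes U: "(U, x) \<in> A" and F: "smooth_on (x ` U) F"
    and K: "compact K" "K \<subseteq> x ` U" "\<And>z. z \<in> x ` U \<Longrightarrow> z \<notin> K \<Longrightarrow> F z = 0"
  shows "(\<lambda>q. if q \<in> U then F (x q) else 0) \<in> smooth_funs A" (is "?h \<in> _")
  unfolding smooth_funs_iff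
proof (intro allI impI)
  fix V y k assume V: "(V, y) \<in> A"
  define K' where "K' = inv_into U x ` K"
  have "compact K'"
    unfolding K'_def using chart_homeo[OF U] K
    by (intro compact_continuous_image) (auto simp: homeomorphism_def intro: continuous_on_subset)
  then have "closed K'" by (rule compact_imp_closed)
  have K'U: "K' \<subseteq> U" using K(2) by (auto simp: K'_def inv_into_into)
  let ?h' = "?h \<circ> inv_into V y"
  have "C_k_on k (y ` (V \<inter> U)) ?h'"
  proof (rule C_k_on_transfer)
    show "C_k_on k (y ` (V \<inter> U)) (F \<circ> (x \<circ> inv_into V y))"
    proof (rule C_k_on_compose)
      show "C_k_on k (y ` (V \<inter> U)) (x \<circ> inv_into V y)"
        using charts_compatible[OF V U] by (simp add: smooth_on_def)
      show "C_k_on k (x ` U) F" using F by (simp add: smooth_on_def)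
    qed (use V U open_chart_image chart_open in auto)
  qed (use V U open_chart_image chart_open in auto)
  moreover have "C_k_on k (y ` (V \<inter> - K')) ?h'"
  proof (rule C_k_on_transfer)
    show "open (y ` (V \<inter> - K'))" using V \<open>closed K'\<close> by (intro open_chart_image) auto
    then show "C_k_on k (y ` (V \<inter> - K')) (\<lambda>_. 0)" by (rule C_k_on_const)
    have "F (x q) = 0" if "q \<in> U" "q \<notin> K'" for q
    proof -
      have "x q \<notin> K" using that U by (force simp: K'_def)
      then show ?thesis using K(3) that by auto
    qed
    then show "0 = ?h' z" if "z \<in> y ` (V \<inter> - K')" for z using that V by auto
  qed
  moreover have "y ` V = y ` (V \<inter> U) \<union> y ` (V \<inter> - K')" using K'U by auto
  ultimately show "C_k_on k (y ` V) ?h'"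
    using C_k_on_Un[of "y ` (V \<inter> U)" "y ` (V \<inter> - K')"] V U \<open>closed K'\<close> open_chart_image chart_open
    by (simp add: open_Compl)
qed

lemma tangent_spaceD:
  assumes "v \<in> tangent_space A p"
  shows "f \<notin> smooth_funs A \<Longrightarrow> v f = 0"
    and "f \<in> smooth_funs A \<Longrightarrow> h \<in> smooth_funs A \<Longrightarrow> v (f + h) = v f + v h"
    and "f \<in> smooth_funs A \<Longrightarrow> v (c *\<^sub>R f) = c * v f"
    and "f \<in> smooth_funs A \<Longrightarrow> h \<in> smooth_funs A \<Longrightarrow> v (f * h) = f p * v h + h p * v f"
  using assms by (auto simp: tangent_space_def)

lemma tangent_space_diff:
  assumes "v \<in> tangent_space A p" "f \<in> smooth_funs A" "h \<in> smooth_funs A"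
  shows "v (f - h) = v f - v h"
  using tangent_spaceD(2)[OF assms(1,2), of "(-1) *\<^sub>R h"] tangent_spaceD(3)[OF assms(1,3), of "-1"] assms
  by simp

lemma tangent_space_0: "v \<in> tangent_space A p \<Longrightarrow> v 0 = 0"
  using tangent_spaceD(3)[of v p 0 0] by simp

lemma tangent_space_1: "v \<in> tangent_space A p \<Longrightarrow> v 1 = 0"
  using tangent_spaceD(4)[of v p 1 1] by simp

lemma subspace_tangent_space: "subspace (tangent_space A p)"
  by (rule subspaceI) (auto simp: tangent_space_def scaleR_fun_def algebra_simps)

lemma vfieldsD:
  assumes "X \<in> vfields A"
  shows "X p \<in> tangent_space A p" "f \<in> smooth_funs A \<Longrightarrow> vf_app X f \<in> smooth_funs A"
  using assms by (auto simp: vfields_def)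

lemma vf_app_not_smooth: "X \<in> vfields A \<Longrightarrow> f \<notin> smooth_funs A \<Longrightarrow> vf_app X f = 0"
  using tangent_spaceD(1)[OF vfieldsD(1)] by (auto simp: vf_app_def)

lemma vf_app_smooth [simp]: "X \<in> vfields A \<Longrightarrow> vf_app X f \<in> smooth_funs A"
  using vfieldsD(2) vf_app_not_smooth by (cases "f \<in> smooth_funs A") auto

lemma vf_app_add:
  "X \<in> vfields A \<Longrightarrow> f \<in> smooth_funs A \<Longrightarrow> h \<in> smooth_funs A \<Longrightarrow>
    vf_app X (f + h) = vf_app X f + vf_app X h"
  by (rule ext) (simp add: vf_app_def tangent_spaceD(2)[OF vfieldsD(1)])

lemma vf_app_diff:
  "X \<in> vfields A \<Longrightarrow> f \<in> smooth_funs A \<Longrightarrow> h \<in> smooth_funs A \<Longrightarrow>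
    vf_app X (f - h) = vf_app X f - vf_app X h"
  by (rule ext) (simp add: vf_app_def tangent_space_diff[OF vfieldsD(1)])

lemma vf_app_scaleR:
  "X \<in> vfields A \<Longrightarrow> f \<in> smooth_funs A \<Longrightarrow> vf_app X (c *\<^sub>R f) = c *\<^sub>R vf_app X f"
  by (rule ext) (simp add: vf_app_def tangent_spaceD(3)[OF vfieldsD(1)])

lemma vf_app_mult:
  "X \<in> vfields A \<Longrightarrow> f \<in> smooth_funs A \<Longrightarrow> h \<in> smooth_funs A \<Longrightarrow>
    vf_app X (f * h) = f * vf_app X h + h * vf_app X f"
  by (rule ext) (simp add: vf_app_def tangent_spaceD(4)[OF vfieldsD(1)])

lemma vf_app_0: "X \<in> vfields A \<Longrightarrow> vf_app X 0 = 0"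
  by (rule ext) (simp add: vf_app_def tangent_space_0[OF vfieldsD(1)])

lemma vf_app_1: "X \<in> vfields A \<Longrightarrow> vf_app X 1 = 0"
  by (rule ext) (simp add: vf_app_def tangent_space_1[OF vfieldsD(1)])

lemma vfields_subspace: "subspace (vfields A)"
proof (rule subspaceI)
  note T = subspace_tangent_space
  show "0 \<in> vfields A"
    using subspace_0[OF T] by (auto simp: vfields_def vf_app_def zero_fun_def[symmetric] simp del: vf_app_smooth)
  show "X + Y \<in> vfields A" if XY: "X \<in> vfields A" "Y \<in> vfields A" for X Y
  proof -
    have "vf_app (X + Y) f = vf_app X f + vf_app Y f" for f by (auto simp: vf_app_def)
    then have "vf_app (X + Y) f \<in> smooth_funs A" for f using XY by simp
    moreover have "(X + Y) p \<in> tangent_space A p" for p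
      using subspace_add[OF T vfieldsD(1)[OF XY(1)] vfieldsD(1)[OF XY(2)]] by simp
    ultimately show ?thesis unfolding vfields_def by blast
  qed
  show "c *\<^sub>R X \<in> vfields A" if X: "X \<in> vfields A" for X c
  proof -
    have "vf_app (c *\<^sub>R X) f = c *\<^sub>R vf_app X f" for f by (auto simp: vf_app_def)
    then have "vf_app (c *\<^sub>R X) f \<in> smooth_funs A" for f using X by simp
    moreover have "(c *\<^sub>R X) p \<in> tangent_space A p" for p
      using subspace_scale[OF T vfieldsD(1)[OF X]] by simp
    ultimately show ?thesis unfolding vfields_def by blast
  qed
qed

lemma vf_app_lie_bracket:
  "vf_app (lie_bracket X Y) f = vf_app X (vf_app Y f) - vf_app Y (vf_app X f)"
  by (auto simp: vf_app_def lie_bracket_def)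

text \<open>In \<open>X (Y (f h)) - Y (X (f h))\<close> the mixed terms \<open>(X f)(Y h)\<close> cancel, which leaves the Leibniz rule.\<close>

lemma lie_bracket_vfields [simp]:
  assumes X: "X \<in> vfields A" and Y: "Y \<in> vfields A"
  shows "lie_bracket X Y \<in> vfields A"
proof -
  have eq: "lie_bracket X Y p f = (vf_app X (vf_app Y f) - vf_app Y (vf_app X f)) p" for p f
    by (auto simp: vf_app_def lie_bracket_def)
  have "lie_bracket X Y p \<in> tangent_space A p" for p
    unfolding tangent_space_def mem_Collect_eq eq
    using X Y
    by (auto simp: vf_app_not_smooth vf_app_0 vf_app_add vf_app_scaleR vf_app_mult algebra_simps)
  moreover have "vf_app (lie_bracket X Y) f \<in> smooth_funs A" for f
    using X Y by (simp add: vf_app_lie_bracket)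
  ultimately show ?thesis unfolding vfields_def by blast
qed

lemma lie_bracket_jacobi:
  assumes "X \<in> vfields A" "Y \<in> vfields A" "Z \<in> vfields A"
  shows "lie_bracket Z (lie_bracket X Y)
    = lie_bracket (lie_bracket Z X) Y + lie_bracket X (lie_bracket Z Y)"
proof (intro ext)
  fix p f
  show "lie_bracket Z (lie_bracket X Y) p f
    = (lie_bracket (lie_bracket Z X) Y + lie_bracket X (lie_bracket Z Y)) p f"
  proof -
    have eq: "lie_bracket V W p h = (vf_app V (vf_app W h) - vf_app W (vf_app V h)) p" for V W h
      by (simp add: vf_app_def lie_bracket_def)
    show ?thesis using assms by (simp add: eq vf_app_lie_bracket vf_app_diff)
  qed
qed

section \<open>Extending tangent vectors to vector fields\<close>

text \<open>The field \<open>B \<partial>\<^sub>b\<close> of the chart, continued by zero; the condition on \<open>f\<close> is the convention that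
  derivations vanish on functions that are not smooth.\<close>

definition cutoff_coord_field :: "'m set \<Rightarrow> ('m \<Rightarrow> 'e) \<Rightarrow> ('e \<Rightarrow> real) \<Rightarrow> 'e \<Rightarrow> 'm vfield" where
  "cutoff_coord_field U x B b = (\<lambda>q f. if f \<in> smooth_funs A \<and> q \<in> U
     then B (x q) * frechet_derivative (f \<circ> inv_into U x) (at (x q)) b else 0)"

lemma smooth_fun_chart_derivative:
  assumes "(U, x) \<in> A" "f \<in> smooth_funs A" "q \<in> U"
  shows "((f \<circ> inv_into U x) has_derivative frechet_derivative (f \<circ> inv_into U x) (at (x q))) (at (x q))"
  using assms C_k_on_SucD[of 0 "x ` U" "f \<circ> inv_into U x" "x q"]
  by (force simp: smooth_funs_iff simp del: C_k_on.simps(1))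

lemma frechet_derivative_eqI:
  assumes "(f has_derivative D) (at x)"
  shows "frechet_derivative f (at x) v = D v"
  using frechet_derivative_at[OF assms] by simp

lemma cutoff_coord_field_vfields:
  assumes U: "(U, x) \<in> A" and B: "smooth_on UNIV B"
    and K: "compact K" "K \<subseteq> x ` U" "\<And>z. z \<notin> K \<Longrightarrow> B z = 0"
  shows "cutoff_coord_field U x B b \<in> vfields A"
proof -
  let ?X = "cutoff_coord_field U x B b"
  have "?X q \<in> tangent_space A q" for q
  proof (cases "q \<in> U")
    case True
    note d = smooth_fun_chart_derivative[OF U _ True]
    have "frechet_derivative ((f + h) \<circ> inv_into U x) (at (x q)) b =
        frechet_derivative (f \<circ> inv_into U x) (at (x q)) b +
        frechet_derivative (h \<circ> inv_into U x) (at (x q)) b"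
      if "f \<in> smooth_funs A" "h \<in> smooth_funs A" for f h
      using frechet_derivative_eqI[OF has_derivative_add[OF d[OF that(1)] d[OF that(2)]]]
      by (simp add: o_def)
    moreover have "frechet_derivative ((c *\<^sub>R f) \<circ> inv_into U x) (at (x q)) b =
        c * frechet_derivative (f \<circ> inv_into U x) (at (x q)) b"
      if "f \<in> smooth_funs A" for f c
      using frechet_derivative_eqI[OF has_derivative_scaleR_right[OF d[OF that]]]
      by (simp add: o_def scaleR_fun_def)
    moreover have "frechet_derivative ((f * h) \<circ> inv_into U x) (at (x q)) b =
        f q * frechet_derivative (h \<circ> inv_into U x) (at (x q)) b +
        frechet_derivative (f \<circ> inv_into U x) (at (x q)) b * h q"
      if "f \<in> smooth_funs A" "h \<in> smooth_funs A" for f h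
      using frechet_derivative_eqI[OF has_derivative_mult[OF d[OF that(1)] d[OF that(2)]]] True U
      by (simp add: o_def)
    ultimately show ?thesis
      using True by (auto simp: tangent_space_def cutoff_coord_field_def algebra_simps)
  next
    case False
    then show ?thesis by (auto simp: tangent_space_def cutoff_coord_field_def)
  qed
  moreover have "vf_app ?X f \<in> smooth_funs A" if f: "f \<in> smooth_funs A" for f
  proof -
    let ?F = "\<lambda>z. B z * frechet_derivative (f \<circ> inv_into U x) (at z) b"
    have "smooth_on (x ` U) ?F"
      unfolding smooth_on_def
    proof
      fix k
      have "C_k_on k (x ` U) B" using B by (auto simp: smooth_on_def intro: C_k_on_subset)
      moreover have "C_k_on k (x ` U) (\<lambda>z. frechet_derivative (f \<circ> inv_into U x) (at z) b)"
        using f U by (intro C_k_on_frechet_derivative) (simp add: smooth_funs_iff)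
      ultimately show "C_k_on k (x ` U) ?F" using U chart_open by (intro C_k_on_mult) auto
    qed
    from zero_extension_smooth[OF U this K(1,2)] K(3)
    have "(\<lambda>q. if q \<in> U then ?F (x q) else 0) \<in> smooth_funs A" by simp
    also have "(\<lambda>q. if q \<in> U then ?F (x q) else 0) = vf_app ?X f"
      using f by (auto simp: vf_app_def cutoff_coord_field_def)
    finally show ?thesis .
  qed
  ultimately show ?thesis unfolding vfields_def by blast
qed

lemma sum_fun_apply: "(\<Sum>i\<in>I. F i) z = (\<Sum>i\<in>I. F i z)" for F :: "'i \<Rightarrow> 'y \<Rightarrow> 'z::comm_monoid_add"
  by (induction I rule: infinite_finite_induct) auto

text \<open>The values at \<open>p\<close> of global vector fields form a subspace of the tangent space that contains the
  coordinate derivations. These are independent, since they are dual to the coordinate functions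
  \<open>f c\<close> centred at \<open>p\<close>, and there are as many of them as elements of \<open>E\<close>; so they span.\<close>

lemma tangent_vector_extends:
  assumes E: "span E = tangent_space A p" "finite E" "card E = DIM('e)"
    and v: "v \<in> tangent_space A p"
  obtains X where "X \<in> vfields A" "X p = v"
proof -
  have "p \<in> (\<Union>(U, x)\<in>A. U)" unfolding charts_cover by simp
  then obtain U x where U: "(U, x) \<in> A" and p: "p \<in> U" by auto
  have "open (x ` U)" "x p \<in> x ` U" using U p chart_open by auto
  then obtain r where r: "r > 0" "cball (x p) r \<subseteq> x ` U" using open_contains_cball by blast
  obtain B :: "'e \<Rightarrow> real"
    where B: "smooth_on UNIV B" "B (x p) = 1" "\<And>y. y \<notin> cball (x p) r \<Longrightarrow> B y = 0"
    using smooth_bump_exists[OF r(1), where a = "x p"] by metis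
  define \<delta> where "\<delta> = (\<lambda>b. cutoff_coord_field U x B b p)"
  define f where "f = (\<lambda>c q. if q \<in> U then B (x q) * ((x q - x p) \<bullet> c) else 0)"
  have f: "f c \<in> smooth_funs A" for c
    unfolding f_def
  proof (rule zero_extension_smooth[OF U _ compact_cball r(2)])
    show "smooth_on (x ` U) (\<lambda>z. B z * ((z - x p) \<bullet> c))"
      unfolding smooth_on_def
    proof
      fix k
      have "C_k_on k (x ` U) B" using B by (auto simp: smooth_on_def intro: C_k_on_subset)
      moreover have "C_k_on k (x ` U) (\<lambda>z. z \<bullet> c + - (x p \<bullet> c))"
        using U chart_open
        by (intro C_k_on_add C_k_on_const C_k_on_bounded_linear bounded_linear_inner_left) auto
      ultimately show "C_k_on k (x ` U) (\<lambda>z. B z * ((z - x p) \<bullet> c))"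
        using U chart_open by (auto simp: inner_diff_left intro!: C_k_on_mult)
    qed
  qed (use B in auto)
  have dual: "\<delta> b (f c) = b \<bullet> c" for b c
  proof -
    have "(B has_derivative frechet_derivative B (at (x p))) (at (x p))"
      using B(1) by (intro C_k_on_SucD[of 0 UNIV]) (auto simp: smooth_on_def simp del: C_k_on.simps)
    then have "((\<lambda>z. B z * ((z - x p) \<bullet> c)) has_derivative (\<lambda>w. w \<bullet> c)) (at (x p))"
      using B(2) by (auto intro!: derivative_eq_intros)
    then have "((f c \<circ> inv_into U x) has_derivative (\<lambda>w. w \<bullet> c)) (at (x p))"
      by (rule has_derivative_transform_within_open[OF _ \<open>open (x ` U)\<close> \<open>x p \<in> x ` U\<close>])
         (use U in \<open>auto simp: f_def\<close>)
    then show ?thesis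
      using f p B(2) by (simp add: \<delta>_def cutoff_coord_field_def frechet_derivative_eqI)
  qed
  have inj: "inj_on \<delta> Basis"
  proof (rule inj_onI)
    fix b c :: 'e assume bc: "b \<in> Basis" "c \<in> Basis" "\<delta> b = \<delta> c"
    then have "b \<bullet> b = c \<bullet> b" using dual by metis
    then show "b = c" using bc by (metis inner_Basis zero_neq_one)
  qed
  have coeff_0: "u w = 0" if "(\<Sum>w\<in>\<delta> ` Basis. u w *\<^sub>R w) = 0" "w \<in> \<delta> ` Basis"
    for u :: "'m tvec \<Rightarrow> real" and w
  proof -
    note 0 = that(1)
    from that(2)
    obtain c where c: "c \<in> Basis" "w = \<delta> c" by auto
    have "0 = (\<Sum>b\<in>Basis. u (\<delta> b) *\<^sub>R \<delta> b) (f c)" using 0 by (simp add: sum.reindex[OF inj])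
    also have "\<dots> = (\<Sum>b\<in>Basis. u (\<delta> b) * (b \<bullet> c))" by (simp add: sum_fun_apply scaleR_fun_def dual)
    also have "\<dots> = u (\<delta> c)" using c by (simp add: inner_Basis if_distrib cong: if_cong)
    finally show ?thesis using c by simp
  qed
  then have indep: "independent (\<delta> ` Basis)" by (subst dependent_finite) auto
  have vf: "cutoff_coord_field U x B b \<in> vfields A" for b
    by (rule cutoff_coord_field_vfields[OF U B(1) compact_cball r(2) B(3)])
  then have sub: "\<delta> ` Basis \<subseteq> span E" using E(1) vfieldsD(1) by (auto simp: \<delta>_def)
  have "span E \<subseteq> span (\<delta> ` Basis)"
  proof (rule span_minimal[OF _ subspace_span], rule ccontr)
    \<comment> \<open>A further independent vector would exceed the size of the spanning set \<open>E\<close>.\<close>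
    assume "\<not> E \<subseteq> span (\<delta> ` Basis)"
    then obtain e where e: "e \<in> E" "e \<notin> span (\<delta> ` Basis)" by blast
    have "independent (insert e (\<delta> ` Basis))" using e(2) indep by (simp add: independent_insert)
    moreover have "insert e (\<delta> ` Basis) \<subseteq> span E" using e(1) sub by (simp add: span_base)
    ultimately have "card (insert e (\<delta> ` Basis)) \<le> card E" using independent_span_bound[OF E(2)] by blast
    moreover have "e \<notin> \<delta> ` Basis" using e(2) span_base[of e] by metis
    ultimately show False using E(3) card_image[OF inj] by simp
  qed
  also have "\<dots> \<subseteq> (\<lambda>X. X p) ` vfields A"
  proof (rule span_minimal)
    have "linear (\<lambda>X::'m vfield. X p)" by (rule linearI) (auto simp: scaleR_fun_def)
    then show "subspace ((\<lambda>X. X p) ` vfields A)" using vfields_subspace by (rule linear_subspace_image)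
    show "\<delta> ` Basis \<subseteq> (\<lambda>X. X p) ` vfields A" using vf by (auto simp: \<delta>_def)
  qed
  finally show ?thesis using v E(1) that by blast
qed

end

section \<open>Linear algebra relative to a subspace\<close>

lemma linear_on_spaceD:
  assumes "linear_on_space V L"
  shows "u \<in> V \<Longrightarrow> v \<in> V \<Longrightarrow> L (u + v) = L u + L v"
    and "v \<in> V \<Longrightarrow> L (c *\<^sub>R v) = c *\<^sub>R L v"
  using assms by (auto simp: linear_on_space_def)

lemma linear_on_space_0:
  assumes "linear_on_space V L" "subspace V"
  shows "L 0 = 0"
  using linear_on_spaceD(2)[OF assms(1) subspace_0[OF assms(2)], of 0] by simp

lemma linear_on_space_uminus:
  assumes "linear_on_space V L" "v \<in> V"
  shows "L (- v) = - L v"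
  using linear_on_spaceD(2)[OF assms, of "-1"] by simp

lemma linear_on_space_diff:
  assumes "linear_on_space V L" "subspace V" "u \<in> V" "v \<in> V"
  shows "L (u - v) = L u - L v"
  using linear_on_spaceD(1)[OF assms(1,3) subspace_neg[OF assms(2,4)]]
    linear_on_space_uminus[OF assms(1,4)] by simp

lemma linear_on_space_sum:
  assumes "linear_on_space V L" "subspace V" "\<And>i. i \<in> I \<Longrightarrow> F i \<in> V"
  shows "L (\<Sum>i\<in>I. F i) = (\<Sum>i\<in>I. L (F i))"
  using assms(3)
proof (induction I rule: infinite_finite_induct)
  case (insert i I)
  then have "(\<Sum>i\<in>I. F i) \<in> V" using assms(2) by (intro subspace_sum) auto
  then show ?case using insert linear_on_spaceD(1)[OF assms(1), of "F i" "\<Sum>i\<in>I. F i"] by simp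
qed (auto simp: linear_on_space_0[OF assms(1,2)])

text \<open>Pairing with the elements of the orthonormal basis reads off each coefficient up to sign.\<close>

lemma has_signature_nondegenerate:
  assumes sig: "has_signature V b r s" and lin: "\<And>v. v \<in> V \<Longrightarrow> linear_on_space V (\<lambda>u. b u v)"
    and w: "w \<in> V" "\<And>v. v \<in> V \<Longrightarrow> b w v = 0"
  shows "w = 0"
proof -
  obtain e where inj: "inj_on e {..<r + s}" and span: "span (e ` {..<r + s}) = V"
    and orth: "\<And>i j. i < r + s \<Longrightarrow> j < r + s \<Longrightarrow>
      b (e i) (e j) = (if i \<noteq> j then 0 else if i < r then 1 else - 1)"
    using sig unfolding has_signature_def by blast
  have V: "subspace V" using span subspace_span by metis
  have eV: "e i \<in> V" if "i < r + s" for i using that span by (auto intro: span_base)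
  obtain c where c: "w = (\<Sum>i<r + s. c (e i) *\<^sub>R e i)"
    using w(1) unfolding span[symmetric] by (auto simp: span_finite sum.reindex[OF inj])
  have "c (e j) = 0" if j: "j < r + s" for j
  proof -
    have "0 = b w (e j)" using w(2) eV j by simp
    also have "\<dots> = (\<Sum>i<r + s. b (c (e i) *\<^sub>R e i) (e j))"
      unfolding c using eV V
      by (intro linear_on_space_sum[OF lin[OF eV[OF j]] V]) (auto intro: subspace_scale)
    also have "\<dots> = (\<Sum>i<r + s. if i = j then c (e i) * b (e i) (e j) else 0)"
      using linear_on_spaceD(2)[OF lin[OF eV[OF j]]] eV orth j by (intro sum.cong) auto
    also have "\<dots> = c (e j) * b (e j) (e j)" using j by simp
    finally show ?thesis using orth[OF j j] by (auto split: if_splits)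
  qed
  then show ?thesis unfolding c by simp
qed

text \<open>For independent \<open>a, b\<close> the combination \<open>\<beta>(b) a - \<beta>(a) b\<close> lies in the kernel; it is nonzero
  unless \<open>\<beta>(b) = 0\<close>, and then \<open>b\<close> will do.\<close>

lemma two_dim_meets_kernel:
  fixes S :: "'v::real_vector set" and \<beta> :: "'v \<Rightarrow> real"
  assumes S: "subspace S" "dim S \<ge> 2" and \<beta>: "linear_on_space S \<beta>"
  obtains v where "v \<in> S" "v \<noteq> 0" "\<beta> v = 0"
proof -
  obtain B where B: "B \<subseteq> S" "independent B" "card B = dim S"
    using basis_exists[of S] by metis
  have "finite B" using B(3) S(2) by (intro card_ge_0_finite) simp
  then obtain a b where ab: "a \<in> B" "b \<in> B" "a \<noteq> b"
    using card_le_Suc0_iff_eq[of B] B(3) S(2) by auto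
  have "independent {a, b}" using ab B(2) independent_mono[of B "{a, b}"] by simp
  then have a_span: "a \<notin> span {b}" using ab(3) by (simp add: independent_insert)
  have nz: "x *\<^sub>R a - y *\<^sub>R b \<noteq> 0" if "x \<noteq> 0" for x y
  proof
    assume "x *\<^sub>R a - y *\<^sub>R b = 0"
    then have "inverse x *\<^sub>R (x *\<^sub>R a) = inverse x *\<^sub>R (y *\<^sub>R b)" by simp
    then have "a = (inverse x * y) *\<^sub>R b" using that by simp
    then show False using a_span span_scale[OF span_base[of b "{b}"]] by auto
  qed
  have a: "a \<noteq> 0" "a \<in> S" "b \<in> S" using nz[of 1 0] ab B(1) by auto
  show ?thesis
  proof (cases "\<beta> b = 0")
    case True
    then show ?thesis using that[of b] a ab(2) B(2) dependent_zero by metis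
  next
    case False
    have mem: "\<beta> b *\<^sub>R a \<in> S" "\<beta> a *\<^sub>R b \<in> S" using S(1) a by (auto intro: subspace_scale)
    have "\<beta> (\<beta> b *\<^sub>R a - \<beta> a *\<^sub>R b) = 0"
      using linear_on_space_diff[OF \<beta> S(1) mem] linear_on_spaceD(2)[OF \<beta>] a by simp
    then show ?thesis using that[OF subspace_diff[OF S(1) mem]] nz[OF False] by blast
  qed
qed

section \<open>Lie derivative and exterior derivative\<close>

context smooth_manifold
begin

lemma eval2_smooth:
  "tensor_0_2 A T \<Longrightarrow> X \<in> vfields A \<Longrightarrow> Y \<in> vfields A \<Longrightarrow> eval2 T X Y \<in> smooth_funs A"
  by (simp add: tensor_0_2_def)

lemma tensor_0_2_linear:
  assumes "tensor_0_2 A T" "V \<in> vfields A"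
  shows "linear_on_space (tangent_space A p) (T p (V p))"
    and "linear_on_space (tangent_space A p) (\<lambda>u. T p u (V p))"
  using assms(1) vfieldsD(1)[OF assms(2)] by (auto simp: tensor_0_2_def)

context
  fixes T X Y Z
  assumes T: "tensor_0_2 A T" and X: "X \<in> vfields A" and Y: "Y \<in> vfields A" and Z: "Z \<in> vfields A"
begin

lemma eval2_add_left: "eval2 T (X + Y) Z = eval2 T X Z + eval2 T Y Z"
  using linear_on_spaceD(1)[OF tensor_0_2_linear(2)[OF T Z] vfieldsD(1)[OF X] vfieldsD(1)[OF Y]]
  by (auto simp: eval2_def)

lemma eval2_diff_left: "eval2 T (X - Y) Z = eval2 T X Z - eval2 T Y Z"
  using linear_on_space_diff[OF tensor_0_2_linear(2)[OF T Z] subspace_tangent_space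
      vfieldsD(1)[OF X] vfieldsD(1)[OF Y]]
  by (auto simp: eval2_def)

lemma eval2_diff_right: "eval2 T Z (X - Y) = eval2 T Z X - eval2 T Z Y"
  using linear_on_space_diff[OF tensor_0_2_linear(1)[OF T Z] subspace_tangent_space
      vfieldsD(1)[OF X] vfieldsD(1)[OF Y]]
  by (auto simp: eval2_def)

end

lemma eval2_minus_left:
  assumes "tensor_0_2 A T" "X \<in> vfields A" "Y \<in> vfields A"
  shows "eval2 T (- X) Y = - eval2 T X Y"
  using linear_on_space_uminus[OF tensor_0_2_linear(2)[OF assms(1,3)] vfieldsD(1)[OF assms(2)]]
  by (auto simp: eval2_def)

lemma eval2_minus_right:
  assumes "tensor_0_2 A T" "X \<in> vfields A" "Y \<in> vfields A"
  shows "eval2 T X (- Y) = - eval2 T X Y"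
  using linear_on_space_uminus[OF tensor_0_2_linear(1)[OF assms(1,2)] vfieldsD(1)[OF assms(3)]]
  by (auto simp: eval2_def)

text \<open>This is \<open>L\<^sub>Z (dT) = d (L\<^sub>Z T)\<close>, evaluated on three fields and with \<open>d (L\<^sub>Z T)\<close> written out. Besides the
  definition of the bracket, it comes from the Jacobi identity in the form that \<open>L\<^sub>Z\<close> is a derivation
  of the bracket.\<close>

lemma lie_deriv_ext_d2_commute:
  assumes T: "tensor_0_2 A T"
    and Z: "Z \<in> vfields A" and X: "X \<in> vfields A" and Y: "Y \<in> vfields A" and W: "W \<in> vfields A"
  shows "vf_app Z (ext_d2 T X Y W)
      - ext_d2 T (lie_bracket Z X) Y W - ext_d2 T X (lie_bracket Z Y) W - ext_d2 T X Y (lie_bracket Z W)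
    = vf_app X (lie_deriv2 Z T Y W) - vf_app Y (lie_deriv2 Z T X W) + vf_app W (lie_deriv2 Z T X Y)
      - lie_deriv2 Z T (lie_bracket X Y) W + lie_deriv2 Z T (lie_bracket X W) Y
      - lie_deriv2 Z T (lie_bracket Y W) X"
  using Z X Y W
  by (simp add: ext_d2_def lie_deriv2_def vf_app_add vf_app_diff vf_app_lie_bracket
      lie_bracket_jacobi[of _ _ Z] eval2_smooth[OF T] eval2_add_left[OF T] algebra_simps)

end

section \<open>Almost paracontact metric structures\<close>

context almost_paracontact_metric
begin

abbreviation \<Phi> :: "'m \<Rightarrow> 'm tvec \<Rightarrow> 'm tvec \<Rightarrow> real" where "\<Phi> \<equiv> fundamental_form \<phi> g"

lemma vector_extends:
  assumes "v \<in> tangent_space A p"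
  obtains X where "X \<in> vfields A" "X p = v"
proof -
  have "has_signature (tangent_space A p) (g p) (n + 1) n"
    using metric by (simp add: pseudo_riemannian_metric_def)
  then obtain e :: "nat \<Rightarrow> 'm tvec" where e: "inj_on e {..<n + 1 + n}" "span (e ` {..<n + 1 + n}) = tangent_space A p"
    unfolding has_signature_def by blast
  show ?thesis
  proof (rule tangent_vector_extends[OF e(2) _ _ assms])
    show "card (e ` {..<n + 1 + n}) = DIM('e)" using card_image[OF e(1)] dimension by simp
  qed (use that in auto)
qed

lemma g_tensor: "tensor_0_2 A g"
  using metric by (simp add: pseudo_riemannian_metric_def)

lemma g_sym: "u \<in> tangent_space A p \<Longrightarrow> v \<in> tangent_space A p \<Longrightarrow> g p u v = g p v u"
  using metric by (simp add: pseudo_riemannian_metric_def)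

lemma g_linear:
  assumes "v \<in> tangent_space A p"
  shows "linear_on_space (tangent_space A p) (g p v)"
    and "linear_on_space (tangent_space A p) (\<lambda>u. g p u v)"
  using g_tensor assms by (auto simp: tensor_0_2_def)

lemma g_nondegenerate:
  assumes "w \<in> tangent_space A p" "\<And>v. v \<in> tangent_space A p \<Longrightarrow> g p w v = 0"
  shows "w = 0"
  using metric has_signature_nondegenerate[of "tangent_space A p" "g p" "n + 1" n, OF _ g_linear(2) assms]
  by (simp add: pseudo_riemannian_metric_def)

lemma xi_tangent [simp]: "\<xi> p \<in> tangent_space A p"
  using xi_field by (rule vfieldsD)

lemma phi_tangent [simp]: "v \<in> tangent_space A p \<Longrightarrow> \<phi> p v \<in> tangent_space A p"
  using phi_tensor by (simp add: tensor_1_1_def)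

lemma phi_linear: "linear_on_space (tangent_space A p) (\<phi> p)"
  using phi_tensor by (simp add: tensor_1_1_def)

lemma eta_linear: "linear_on_space (tangent_space A p) (\<eta> p)"
  using eta_form by (simp add: one_form_def)

lemma xi_nonzero: "\<xi> p \<noteq> 0"
  using eta_xi[of p] linear_on_space_0[OF eta_linear subspace_tangent_space, of p] by auto

text \<open>From \<open>\<phi>\<^sup>2 \<xi> = 0\<close>, applying \<open>\<phi>\<^sup>2 = Id - \<eta> \<otimes> \<xi>\<close> to \<open>\<phi> \<xi>\<close> shows \<open>\<phi> \<xi> = c \<xi>\<close>; then \<open>c\<^sup>2 \<xi> = 0\<close>.\<close>

lemma phi_xi: "\<phi> p (\<xi> p) = 0"
proof -
  have 0: "\<phi> p (\<phi> p (\<xi> p)) = 0" using phi_sq[OF xi_tangent] eta_xi by simp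
  define c where "c = \<eta> p (\<phi> p (\<xi> p))"
  have "\<phi> p (\<phi> p (\<phi> p (\<xi> p))) = \<phi> p (\<xi> p) - c *\<^sub>R \<xi> p"
    using phi_sq[of "\<phi> p (\<xi> p)" p] by (simp add: c_def)
  then have c: "\<phi> p (\<xi> p) = c *\<^sub>R \<xi> p"
    using 0 linear_on_space_0[OF phi_linear subspace_tangent_space] by simp
  have "0 = c *\<^sub>R c *\<^sub>R \<xi> p"
    using 0 linear_on_spaceD(2)[OF phi_linear xi_tangent, of p c] c by simp
  then show ?thesis using c xi_nonzero[of p] by (metis scaleR_eq_0_iff)
qed

text \<open>The two ways of bracketing \<open>\<phi>\<^sup>3 v\<close> differ by \<open>\<eta>(\<phi> v) \<xi>\<close>.\<close>

lemma eta_phi: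
  assumes v: "v \<in> tangent_space A p"
  shows "\<eta> p (\<phi> p v) = 0"
proof -
  have \<eta>\<xi>: "\<eta> p v *\<^sub>R \<xi> p \<in> tangent_space A p"
    using subspace_scale[OF subspace_tangent_space xi_tangent] .
  have "\<phi> p (\<phi> p (\<phi> p v)) = \<phi> p v - \<eta> p (\<phi> p v) *\<^sub>R \<xi> p"
    using phi_sq[of "\<phi> p v" p] v by simp
  moreover have "\<phi> p (\<phi> p (\<phi> p v)) = \<phi> p v"
    using linear_on_space_diff[OF phi_linear subspace_tangent_space v \<eta>\<xi>]
      linear_on_spaceD(2)[OF phi_linear xi_tangent, of p "\<eta> p v"] phi_xi[of p]
    by (simp add: phi_sq[OF v])
  ultimately show ?thesis using xi_nonzero[of p] by simp
qed

lemma eta_eq_g_xi: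
  assumes v: "v \<in> tangent_space A p"
  shows "\<eta> p v = g p v (\<xi> p)"
proof -
  have "g p (\<phi> p v) 0 = 0"
    using v by (intro linear_on_space_0[OF g_linear(1)] subspace_tangent_space) simp
  then show ?thesis using compatible[OF v xi_tangent] eta_xi phi_xi by simp
qed

text \<open>Compatibility for the pair \<open>u, \<phi> v\<close>, where \<open>\<phi>\<^sup>2 v\<close> differs from \<open>v\<close> by a multiple of \<open>\<xi>\<close>,
  which is orthogonal to \<open>\<phi> u\<close>.\<close>

lemma phi_skew:
  assumes u: "u \<in> tangent_space A p" and v: "v \<in> tangent_space A p"
  shows "g p (\<phi> p u) v = - g p u (\<phi> p v)"
proof -
  have \<eta>\<xi>: "\<eta> p v *\<^sub>R \<xi> p \<in> tangent_space A p"
    using subspace_scale[OF subspace_tangent_space xi_tangent] .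
  have "g p (\<phi> p u) (\<phi> p (\<phi> p v)) = - g p u (\<phi> p v)"
    using u v by (simp add: compatible eta_phi)
  moreover have "g p (\<phi> p u) (\<phi> p (\<phi> p v)) = g p (\<phi> p u) v - \<eta> p v * g p (\<phi> p u) (\<xi> p)"
    using u linear_on_space_diff[OF g_linear(1) subspace_tangent_space v \<eta>\<xi>, of "\<phi> p u"]
      linear_on_spaceD(2)[OF g_linear(1) xi_tangent, of "\<phi> p u" p]
    by (simp add: phi_sq[OF v])
  moreover have "g p (\<phi> p u) (\<xi> p) = 0" using u eta_phi[OF u] eta_eq_g_xi[of "\<phi> p u" p] by simp
  ultimately show ?thesis by simp
qed

lemma Phi_skew:
  assumes "u \<in> tangent_space A p" "v \<in> tangent_space A p"
  shows "\<Phi> p u v = - \<Phi> p v u"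
  using phi_skew[OF assms] g_sym[of u p "\<phi> p v"] assms by (simp add: fundamental_form_def)

lemma Phi_xi:
  assumes v: "v \<in> tangent_space A p"
  shows "\<Phi> p (\<xi> p) v = 0" "\<Phi> p v (\<xi> p) = 0"
proof -
  show *: "\<Phi> p (\<xi> p) v = 0"
    using linear_on_space_0[OF g_linear(2)[OF v] subspace_tangent_space]
    by (simp add: fundamental_form_def phi_xi)
  then show "\<Phi> p v (\<xi> p) = 0" using Phi_skew[OF v xi_tangent] by simp
qed

lemma Phi_tensor: "tensor_0_2 A \<Phi>"
proof -
  have "linear_on_space (tangent_space A p) (\<Phi> p u)" if "u \<in> tangent_space A p" for p u
    using g_linear(1)[OF phi_tangent[OF that]] by (simp add: fundamental_form_def linear_on_space_def)
  moreover have "linear_on_space (tangent_space A p) (\<lambda>u. \<Phi> p u v)" if "v \<in> tangent_space A p" for p v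
    using g_linear(2)[OF that] phi_linear[of p] by (simp add: fundamental_form_def linear_on_space_def)
  moreover have "eval2 \<Phi> X Y \<in> smooth_funs A" if "X \<in> vfields A" "Y \<in> vfields A" for X Y
  proof -
    have "eval1 \<phi> X \<in> vfields A" using phi_tensor that by (simp add: tensor_1_1_def)
    moreover have "eval2 \<Phi> X Y = eval2 g (eval1 \<phi> X) Y"
      by (simp add: eval2_def eval1_def fundamental_form_def)
    ultimately show ?thesis using g_tensor that by (simp add: tensor_0_2_def)
  qed
  ultimately show ?thesis by (simp add: tensor_0_2_def)
qed

text \<open>Since both eigenspaces of \<open>\<phi>\<close> have dimension at least two, \<open>\<beta>\<close> vanishes on some nonzero \<open>a\<close> with
  \<open>\<phi> a = a\<close> and some nonzero \<open>b\<close> with \<open>\<phi> b = -b\<close>. Inserting \<open>a\<close> into \<open>\<beta> \<and> \<Phi> = 0\<close> makes \<open>\<beta> \<otimes> g(a, \<cdot>)\<close>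
  symmetric, so if \<open>\<beta> \<noteq> 0\<close> then \<open>g(a, \<cdot>)\<close>, and likewise \<open>g(b, \<cdot>)\<close>, is a multiple of \<open>\<beta>\<close>. By
  nondegeneracy \<open>a\<close> and \<open>b\<close> would be proportional, although they are eigenvectors for different
  eigenvalues.\<close>

lemma wedge_Phi_injective:
  assumes n: "n \<ge> 2" and \<beta>: "linear_on_space (tangent_space A p) \<beta>"
    and wedge: "\<And>u v w. u \<in> tangent_space A p \<Longrightarrow> v \<in> tangent_space A p \<Longrightarrow> w \<in> tangent_space A p \<Longrightarrow>
      \<beta> u * \<Phi> p v w - \<beta> v * \<Phi> p u w + \<beta> w * \<Phi> p u v = 0"
    and u: "u \<in> tangent_space A p"
  shows "\<beta> u = 0"
proof (rule ccontr)
  assume \<beta>u: "\<beta> u \<noteq> 0"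
  let ?T = "tangent_space A p"
  let ?D = "\<lambda>c. {v \<in> ?T. \<eta> p v = 0 \<and> \<phi> p v = c *\<^sub>R v}"
  note T = subspace_tangent_space[of p]
  have sub: "subspace (?D c)" for c
  proof (rule subspaceI)
    show "0 \<in> ?D c"
      using subspace_0[OF T] linear_on_space_0[OF eta_linear T] linear_on_space_0[OF phi_linear T] by simp
    show "x + y \<in> ?D c" if "x \<in> ?D c" "y \<in> ?D c" for x y
      using that subspace_add[OF T] linear_on_spaceD(1)[OF eta_linear, of x p y]
        linear_on_spaceD(1)[OF phi_linear, of x p y] by (simp add: scaleR_add_right)
    show "k *\<^sub>R x \<in> ?D c" if "x \<in> ?D c" for k x
      using that subspace_scale[OF T] linear_on_spaceD(2)[OF eta_linear, of x p k]
        linear_on_spaceD(2)[OF phi_linear, of x p k] by (simp add: mult.commute)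
  qed
  have lin: "linear_on_space (?D c) \<beta>" for c
    using \<beta> by (simp add: linear_on_space_def)
  obtain a where a: "a \<in> ?D 1" "a \<noteq> 0" "\<beta> a = 0"
    using two_dim_meets_kernel[OF sub _ lin, of 1] n rank_plus[of p] by auto
  obtain b where b: "b \<in> ?D (-1)" "b \<noteq> 0" "\<beta> b = 0"
    using two_dim_meets_kernel[OF sub _ lin, of "-1"] n rank_minus[of p] by auto
  have aT: "a \<in> ?T" "\<phi> p a = a" and bT: "b \<in> ?T" "\<phi> p b = - b" using a b by auto
  have neg: "g p (- b) w = - g p b w" if "w \<in> ?T" for w
    by (rule linear_on_space_uminus[OF g_linear(2)[OF that] bT(1)])
  have ga: "\<beta> u * g p a w = \<beta> w * g p a u" if w: "w \<in> ?T" for w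
    using wedge[OF u aT(1) w] a(3) Phi_skew[OF u aT(1)] aT(2) by (simp add: fundamental_form_def)
  have gb: "\<beta> u * g p b w = \<beta> w * g p b u" if w: "w \<in> ?T" for w
    using wedge[OF u bT(1) w] b(3) Phi_skew[OF u bT(1)] bT(2) neg[OF w] neg[OF u]
    by (simp add: fundamental_form_def)
  have sa: "g p b u *\<^sub>R a \<in> ?T" and sb: "g p a u *\<^sub>R b \<in> ?T"
    using subspace_scale[OF T] aT bT by auto
  have "g p b u *\<^sub>R a - g p a u *\<^sub>R b = 0"
  proof (rule g_nondegenerate)
    show "g p b u *\<^sub>R a - g p a u *\<^sub>R b \<in> ?T" using subspace_diff[OF T sa sb] .
    fix w assume w: "w \<in> ?T"
    have "g p (g p b u *\<^sub>R a - g p a u *\<^sub>R b) w = g p b u * g p a w - g p a u * g p b w"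
      using linear_on_space_diff[OF g_linear(2)[OF w] T sa sb]
        linear_on_spaceD(2)[OF g_linear(2)[OF w]] aT bT by simp
    moreover have "\<beta> u * (g p b u * g p a w - g p a u * g p b w) = 0"
    proof -
      have "\<beta> u * (g p b u * g p a w - g p a u * g p b w)
          = g p b u * (\<beta> u * g p a w) - g p a u * (\<beta> u * g p b w)" by (simp add: algebra_simps)
      then show ?thesis by (simp add: ga[OF w] gb[OF w])
    qed
    ultimately show "g p (g p b u *\<^sub>R a - g p a u *\<^sub>R b) w = 0" using \<beta>u by simp
  qed
  \<comment> \<open>A multiple of both \<open>a\<close> and \<open>b\<close> is fixed and negated by \<open>\<phi>\<close>, hence zero.\<close>
  then have eq: "g p b u *\<^sub>R a = g p a u *\<^sub>R b" by simp
  have "\<phi> p (g p b u *\<^sub>R a) = g p b u *\<^sub>R a" "\<phi> p (g p a u *\<^sub>R b) = - (g p a u *\<^sub>R b)"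
    using linear_on_spaceD(2)[OF phi_linear] aT bT by simp_all
  then have "g p b u *\<^sub>R a = - (g p b u *\<^sub>R a)" using eq by simp
  then have "g p b u *\<^sub>R a = 0" by (simp add: eq_neg_iff_add_eq_0 flip: scaleR_2)
  then have "g p a u = 0" using eq b(2) by simp
  then have "g p a w = 0" if "w \<in> ?T" for w using ga[OF that] \<beta>u by simp
  then show False using g_nondegenerate[OF aT(1)] a(2) by blast
qed

end

section \<open>Almost paracosymplectic manifolds\<close>

context almost_alpha_paracosymplectic
begin

lemma eval_Phi_xi: "X \<in> vfields A \<Longrightarrow> eval2 \<Phi> \<xi> X = 0" "X \<in> vfields A \<Longrightarrow> eval2 \<Phi> X \<xi> = 0"
  by (auto simp: eval2_def Phi_xi vfieldsD)

lemma eval_Phi_skew: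
  assumes "X \<in> vfields A" "Y \<in> vfields A"
  shows "eval2 \<Phi> X Y = - eval2 \<Phi> Y X"
proof
  fix p
  show "eval2 \<Phi> X Y p = (- eval2 \<Phi> Y X) p"
    using Phi_skew[OF vfieldsD(1)[OF assms(1)] vfieldsD(1)[OF assms(2)], of p] by (simp add: eval2_def)
qed

lemma eval_eta_xi: "eval1 \<eta> \<xi> = 1"
  by (auto simp: eval1_def eta_xi)

lemma eval_eta_smooth: "X \<in> vfields A \<Longrightarrow> eval1 \<eta> X \<in> smooth_funs A"
  using eta_form by (simp add: one_form_def)

lemma lie_xi_eta: "X \<in> vfields A \<Longrightarrow> lie_deriv1 \<xi> \<eta> X = 0"
  using d_eta[OF xi_field, of X] by (simp add: ext_d1_def lie_deriv1_def eval_eta_xi vf_app_1)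

text \<open>Cartan's formula: \<open>\<Phi>(\<xi>, \<cdot>) = 0\<close> removes every term of \<open>d\<Phi>(\<xi>, X, Y)\<close> that is not in
  \<open>L\<^sub>\<xi>\<Phi>(X, Y)\<close>, and reduces \<open>(\<eta> \<and> \<Phi>)(\<xi>, X, Y)\<close> to \<open>\<Phi>(X, Y)\<close>.\<close>

lemma lie_xi_Phi:
  assumes "X \<in> vfields A" "Y \<in> vfields A"
  shows "lie_deriv2 \<xi> \<Phi> X Y = 2 *\<^sub>R (\<alpha> * eval2 \<Phi> X Y)"
proof -
  have "lie_deriv2 \<xi> \<Phi> X Y = ext_d2 \<Phi> \<xi> X Y"
    using assms xi_field eval_Phi_skew[of X "lie_bracket \<xi> Y"]
    by (simp add: lie_deriv2_def ext_d2_def eval_Phi_xi vf_app_0)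
  also have "\<dots> = 2 *\<^sub>R (\<alpha> * wedge_1_2 \<eta> \<Phi> \<xi> X Y)" using d_Phi[OF xi_field assms] .
  also have "wedge_1_2 \<eta> \<Phi> \<xi> X Y = eval2 \<Phi> X Y"
    using assms by (simp add: wedge_1_2_def eval_eta_xi eval_Phi_xi)
  finally show ?thesis .
qed

text \<open>The identity \<open>d\<alpha> \<and> \<Phi> = \<xi>(\<alpha>) \<eta> \<and> \<Phi>\<close>, from \<open>L\<^sub>\<xi> d\<Phi> = d L\<^sub>\<xi> \<Phi>\<close>. Below, \<open>M\<close> states
  \<open>L\<^sub>\<xi>(\<eta> \<and> \<Phi>) = 2\<alpha> \<eta> \<and> \<Phi>\<close>; both sides then contain \<open>2\<alpha> d\<Phi>\<close>, which cancels. Scalings by \<open>2\<close> are written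
  as sums so as to stay within the ring of functions.\<close>

lemma d_alpha_wedge_Phi:
  assumes X: "X \<in> vfields A" and Y: "Y \<in> vfields A" and W: "W \<in> vfields A"
  shows "vf_app X \<alpha> * eval2 \<Phi> Y W - vf_app Y \<alpha> * eval2 \<Phi> X W + vf_app W \<alpha> * eval2 \<Phi> X Y
    = vf_app \<xi> \<alpha> * wedge_1_2 \<eta> \<Phi> X Y W" (is "?S = ?R")
proof -
  note vf = xi_field X Y W
  note smooth = eval2_smooth[OF Phi_tensor] eval_eta_smooth alpha_smooth
  let ?w = "wedge_1_2 \<eta> \<Phi>"
  have w_smooth: "?w X Y W \<in> smooth_funs A"
    using vf by (simp add: wedge_1_2_def smooth)
  have xi_eta: "vf_app \<xi> (eval1 \<eta> V) = eval1 \<eta> (lie_bracket \<xi> V)" if "V \<in> vfields A" for V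
    using lie_xi_eta[OF that] by (simp add: lie_deriv1_def)
  have L: "lie_deriv2 \<xi> \<Phi> V V' = \<alpha> * eval2 \<Phi> V V' + \<alpha> * eval2 \<Phi> V V'"
    if "V \<in> vfields A" "V' \<in> vfields A" for V V'
    using lie_xi_Phi[OF that] by (simp add: scaleR_2)
  have xi_Phi: "vf_app \<xi> (eval2 \<Phi> V V') = \<alpha> * eval2 \<Phi> V V' + \<alpha> * eval2 \<Phi> V V'
      + eval2 \<Phi> (lie_bracket \<xi> V) V' + eval2 \<Phi> V (lie_bracket \<xi> V')"
    if "V \<in> vfields A" "V' \<in> vfields A" for V V'
    using L[OF that] by (simp add: lie_deriv2_def algebra_simps)
  have d: "ext_d2 \<Phi> V1 V2 V3 = \<alpha> * ?w V1 V2 V3 + \<alpha> * ?w V1 V2 V3"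
    if "V1 \<in> vfields A" "V2 \<in> vfields A" "V3 \<in> vfields A" for V1 V2 V3
    using d_Phi[OF that] by (simp add: scaleR_2)
  have M: "vf_app \<xi> (?w X Y W) = \<alpha> * ?w X Y W + \<alpha> * ?w X Y W
      + ?w (lie_bracket \<xi> X) Y W + ?w X (lie_bracket \<xi> Y) W + ?w X Y (lie_bracket \<xi> W)"
    using vf by (simp add: wedge_1_2_def smooth vf_app_add vf_app_diff vf_app_mult xi_eta xi_Phi algebra_simps)
  have xi_d: "vf_app \<xi> (ext_d2 \<Phi> X Y W)
      = (\<alpha> * vf_app \<xi> (?w X Y W) + ?w X Y W * vf_app \<xi> \<alpha>)
      + (\<alpha> * vf_app \<xi> (?w X Y W) + ?w X Y W * vf_app \<xi> \<alpha>)"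
    using smooth_funs_mult[OF alpha_smooth w_smooth]
    by (simp only: d[OF X Y W] vf_app_add[OF xi_field] vf_app_mult[OF xi_field alpha_smooth w_smooth])
  have vf_L: "vf_app V (lie_deriv2 \<xi> \<Phi> V1 V2)
      = (\<alpha> * vf_app V (eval2 \<Phi> V1 V2) + eval2 \<Phi> V1 V2 * vf_app V \<alpha>)
      + (\<alpha> * vf_app V (eval2 \<Phi> V1 V2) + eval2 \<Phi> V1 V2 * vf_app V \<alpha>)"
    if "V \<in> vfields A" "V1 \<in> vfields A" "V2 \<in> vfields A" for V V1 V2
    using smooth_funs_mult[OF alpha_smooth smooth(1)[OF that(2,3)]]
    by (simp only: L[OF that(2,3)] vf_app_add[OF that(1)] vf_app_mult[OF that(1) alpha_smooth smooth(1)[OF that(2,3)]])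
  have lhs: "vf_app \<xi> (ext_d2 \<Phi> X Y W) - ext_d2 \<Phi> (lie_bracket \<xi> X) Y W
      - ext_d2 \<Phi> X (lie_bracket \<xi> Y) W - ext_d2 \<Phi> X Y (lie_bracket \<xi> W)
    = ?R + ?R + \<alpha> * ext_d2 \<Phi> X Y W + \<alpha> * ext_d2 \<Phi> X Y W"
    unfolding xi_d using vf by (simp add: d M algebra_simps)
  have rhs: "vf_app X (lie_deriv2 \<xi> \<Phi> Y W) - vf_app Y (lie_deriv2 \<xi> \<Phi> X W) + vf_app W (lie_deriv2 \<xi> \<Phi> X Y)
      - lie_deriv2 \<xi> \<Phi> (lie_bracket X Y) W + lie_deriv2 \<xi> \<Phi> (lie_bracket X W) Y
      - lie_deriv2 \<xi> \<Phi> (lie_bracket Y W) X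
    = ?S + ?S + \<alpha> * ext_d2 \<Phi> X Y W + \<alpha> * ext_d2 \<Phi> X Y W"
    unfolding vf_L[OF X Y W] vf_L[OF Y X W] vf_L[OF W X Y]
    using vf by (simp add: L ext_d2_def algebra_simps)
  have "?R + ?R = ?S + ?S"
    using lie_deriv_ext_d2_commute[OF Phi_tensor vf] unfolding lhs rhs by (simp only: add_right_cancel)
  then have "2 *\<^sub>R ?S = 2 *\<^sub>R ?R" by (simp only: scaleR_2)
  then show ?thesis by (simp del: scaleR_fun_apply)
qed

text \<open>The covector \<open>\<beta> = d\<alpha> - \<xi>(\<alpha>) \<eta>\<close> is annihilated by \<open>\<and> \<Phi>\<close> at each point, as the identity for
  vector fields localizes by extending tangent vectors.\<close>

lemma d_alpha_eq:
  assumes n: "n \<ge> 2" and v: "v \<in> tangent_space A p"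
  shows "differential \<alpha> p v = vf_app \<xi> \<alpha> p * \<eta> p v"
proof -
  let ?T = "tangent_space A p"
  define \<beta> where "\<beta> = (\<lambda>v. v \<alpha> - vf_app \<xi> \<alpha> p * \<eta> p v)"
  have "\<beta> v = 0"
  proof (rule wedge_Phi_injective[OF n _ _ v])
    show "linear_on_space ?T \<beta>"
      using eta_linear[of p] by (simp add: linear_on_space_def \<beta>_def algebra_simps)
    fix u v w assume "u \<in> ?T" "v \<in> ?T" "w \<in> ?T"
    then obtain X Y W where XYW: "X \<in> vfields A" "X p = u" "Y \<in> vfields A" "Y p = v" "W \<in> vfields A" "W p = w"
      by (metis vector_extends)
    show "\<beta> u * \<Phi> p v w - \<beta> v * \<Phi> p u w + \<beta> w * \<Phi> p u v = 0"
      using fun_cong[OF d_alpha_wedge_Phi[OF XYW(1,3,5)], of p] XYW(2,4,6)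
      by (simp add: \<beta>_def vf_app_def eval2_def eval1_def wedge_1_2_def algebra_simps)
  qed
  then show ?thesis by (simp add: \<beta>_def differential_def)
qed

context
  fixes nabla :: "'m vfield \<Rightarrow> 'm vfield \<Rightarrow> 'm vfield"
  assumes levi_civita: "levi_civita A g nabla"
begin

lemma nabla_vfields [simp]: "X \<in> vfields A \<Longrightarrow> Y \<in> vfields A \<Longrightarrow> nabla X Y \<in> vfields A"
  using levi_civita by (simp add: levi_civita_def affine_connection_def)

lemma nabla_torsion_free:
  "X \<in> vfields A \<Longrightarrow> Y \<in> vfields A \<Longrightarrow> lie_bracket X Y = nabla X Y - nabla Y X"
  using levi_civita by (simp add: levi_civita_def)

lemma nabla_metric:
  "X \<in> vfields A \<Longrightarrow> Y \<in> vfields A \<Longrightarrow> Z \<in> vfields A \<Longrightarrow>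
    vf_app X (eval2 g Y Z) = eval2 g (nabla X Y) Z + eval2 g Y (nabla X Z)"
  using levi_civita by (simp add: levi_civita_def)

lemma eval_g_sym: "X \<in> vfields A \<Longrightarrow> Y \<in> vfields A \<Longrightarrow> eval2 g X Y = eval2 g Y X"
  by (auto simp: eval2_def g_sym vfieldsD)

lemma eval_eta_eq_g: "X \<in> vfields A \<Longrightarrow> eval1 \<eta> X = eval2 g X \<xi>"
  by (auto simp: eval1_def eval2_def eta_eq_g_xi vfieldsD)

text \<open>With \<open>\<eta> = g(\<cdot>, \<xi>)\<close>, metricity and vanishing torsion give
  \<open>d\<eta>(X, Y) = g(\<nabla>\<^sub>X\<xi>, Y) - g(X, \<nabla>\<^sub>Y\<xi>)\<close>.\<close>

lemma nabla_xi_symmetric: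
  assumes X: "X \<in> vfields A" and Y: "Y \<in> vfields A"
  shows "eval2 g (nabla X \<xi>) Y = eval2 g X (nabla Y \<xi>)"
proof -
  note vf = X Y xi_field
  have "0 = vf_app X (eval2 g Y \<xi>) - vf_app Y (eval2 g X \<xi>) - eval2 g (lie_bracket X Y) \<xi>"
    using d_eta[OF X Y] vf by (simp add: ext_d1_def eval_eta_eq_g)
  also have "\<dots> = eval2 g Y (nabla X \<xi>) - eval2 g X (nabla Y \<xi>)"
    using vf by (simp add: nabla_metric nabla_torsion_free eval2_diff_left[OF g_tensor])
  finally show ?thesis using vf eval_g_sym[of "nabla X \<xi>" Y] by simp
qed

text \<open>Differentiate \<open>g(\<xi>, \<xi>) = 1\<close>.\<close>

lemma eta_nabla_xi:
  assumes X: "X \<in> vfields A"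
  shows "eval1 \<eta> (nabla X \<xi>) = 0"
proof -
  have "eval2 g \<xi> \<xi> = 1" using eval_eta_xi eval_eta_eq_g[OF xi_field] by simp
  then have "0 = eval2 g (nabla X \<xi>) \<xi> + eval2 g \<xi> (nabla X \<xi>)"
    using nabla_metric[OF X xi_field xi_field] vf_app_1[OF X] by simp
  also have "\<dots> = 2 *\<^sub>R eval1 \<eta> (nabla X \<xi>)"
    using X xi_field eval_g_sym[of \<xi> "nabla X \<xi>"] by (simp add: eval_eta_eq_g scaleR_2)
  finally show ?thesis by (simp del: scaleR_fun_apply)
qed

text \<open>By symmetry \<open>g(\<nabla>\<^sub>\<xi>\<xi>, Y) = g(\<xi>, \<nabla>\<^sub>Y\<xi>) = \<eta>(\<nabla>\<^sub>Y\<xi>) = 0\<close>, and the values of fields \<open>Y\<close> exhaust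
  the tangent space.\<close>

lemma nabla_xi_xi: "nabla \<xi> \<xi> = 0"
proof
  fix p
  have N: "nabla \<xi> \<xi> \<in> vfields A" using xi_field by simp
  have "nabla \<xi> \<xi> p = 0"
  proof (rule g_nondegenerate)
    show "nabla \<xi> \<xi> p \<in> tangent_space A p" using N by (rule vfieldsD)
    fix v assume "v \<in> tangent_space A p"
    then obtain Y where Y: "Y \<in> vfields A" "Y p = v" by (rule vector_extends)
    have "eval2 g (nabla \<xi> \<xi>) Y = eval2 g (nabla Y \<xi>) \<xi>"
      using nabla_xi_symmetric[OF xi_field Y(1)] eval_g_sym[of \<xi> "nabla Y \<xi>"] Y(1) xi_field by simp
    also have "\<dots> = 0" using eta_nabla_xi[OF Y(1)] eval_eta_eq_g Y(1) xi_field by simp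
    finally show "g p (nabla \<xi> \<xi> p) v = 0" using fun_cong[of _ _ p] Y(2) by (fastforce simp: eval2_def)
  qed
  then show "nabla \<xi> \<xi> p = 0 p" by simp
qed

lemma lie_xi_g:
  assumes X: "X \<in> vfields A" and Y: "Y \<in> vfields A"
  shows "lie_deriv2 \<xi> g X Y = 2 *\<^sub>R eval2 g (nabla X \<xi>) Y"
  using X Y xi_field nabla_xi_symmetric[OF X Y]
  by (simp add: lie_deriv2_def nabla_metric nabla_torsion_free eval2_diff_left[OF g_tensor] eval2_diff_right[OF g_tensor] scaleR_2)

end

end

section \<open>The structural identities\<close>

theorem proposition1:
  fixes A :: "('m::{t2_space, second_countable_topology}, 'e::euclidean_space) chart set"
    and n :: nat
    and \<phi> :: "'m \<Rightarrow> 'm tvec \<Rightarrow> 'm tvec"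
    and \<xi> :: "'m vfield"
    and \<eta> :: "'m \<Rightarrow> 'm tvec \<Rightarrow> real"
    and g :: "'m \<Rightarrow> 'm tvec \<Rightarrow> 'm tvec \<Rightarrow> real"
    and \<alpha> :: "'m \<Rightarrow> real"
    and nabla :: "'m vfield \<Rightarrow> 'm vfield \<Rightarrow> 'm vfield"
  assumes "almost_alpha_paracosymplectic A n \<phi> \<xi> \<eta> g \<alpha>"
    and "levi_civita A g nabla"
  shows "(\<forall>X\<in>vfields A. lie_deriv1 \<xi> \<eta> X = 0) \<and>
    (\<forall>X\<in>vfields A. \<forall>Y\<in>vfields A.
       eval2 g (shape_operator nabla \<xi> X) Y = eval2 g X (shape_operator nabla \<xi> Y)) \<and>
    shape_operator nabla \<xi> \<xi> = 0 \<and>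
    (\<forall>X\<in>vfields A. \<forall>Y\<in>vfields A.
       lie_deriv2 \<xi> (fundamental_form \<phi> g) X Y
         = 2 *\<^sub>R (\<alpha> * eval2 (fundamental_form \<phi> g) X Y)) \<and>
    (\<forall>X\<in>vfields A. \<forall>Y\<in>vfields A.
       lie_deriv2 \<xi> g X Y = (- 2) *\<^sub>R eval2 g (shape_operator nabla \<xi> X) Y) \<and>
    (\<forall>X\<in>vfields A. eval1 \<eta> (shape_operator nabla \<xi> X) = 0) \<and>
    (n \<ge> 2 \<longrightarrow>
       (\<exists>f\<in>smooth_funs A. \<forall>p. \<forall>v\<in>tangent_space A p. differential \<alpha> p v = f p * \<eta> p v))"
proof -
  interpret almost_alpha_paracosymplectic A n \<phi> \<xi> \<eta> g \<alpha> by (rule assms(1))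
  let ?S = "shape_operator nabla \<xi>"
  note N = nabla_vfields[OF assms(2) _ xi_field]
  have gl: "eval2 g (?S X) Y = - eval2 g (nabla X \<xi>) Y" if "X \<in> vfields A" "Y \<in> vfields A" for X Y
    unfolding shape_operator_def by (rule eval2_minus_left[OF g_tensor N[OF that(1)] that(2)])
  have gr: "eval2 g X (?S Y) = - eval2 g X (nabla Y \<xi>)" if "X \<in> vfields A" "Y \<in> vfields A" for X Y
    unfolding shape_operator_def by (rule eval2_minus_right[OF g_tensor that(1) N[OF that(2)]])
  have "eval1 \<eta> (?S X) = 0" if X: "X \<in> vfields A" for X
  proof
    fix p
    show "eval1 \<eta> (?S X) p = 0 p"
      using linear_on_space_uminus[OF eta_linear vfieldsD(1)[OF N[OF X]], of p]
        fun_cong[OF eta_nabla_xi[OF assms(2) X], of p]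
      by (simp add: eval1_def shape_operator_def)
  qed
  moreover have "?S \<xi> = 0" using nabla_xi_xi[OF assms(2)] by (simp add: shape_operator_def)
  moreover have "lie_deriv2 \<xi> g X Y = (- 2) *\<^sub>R eval2 g (?S X) Y"
    if "X \<in> vfields A" "Y \<in> vfields A" for X Y
    using lie_xi_g[OF assms(2) that] gl[OF that] by simp
  moreover have "eval2 g (?S X) Y = eval2 g X (?S Y)" if "X \<in> vfields A" "Y \<in> vfields A" for X Y
    using nabla_xi_symmetric[OF assms(2) that] gl[OF that] gr[OF that] by simp
  moreover have "\<exists>f\<in>smooth_funs A. \<forall>p. \<forall>v\<in>tangent_space A p. differential \<alpha> p v = f p * \<eta> p v"
    if "n \<ge> 2"
    using d_alpha_eq[OF that] vf_app_smooth[OF xi_field, of \<alpha>] by blast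
  ultimately show ?thesis using lie_xi_eta lie_xi_Phi by blast
qed

end
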